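(* Let $T=(V,E)$ be a finite tree with $n\ge1$ edges, and take $m_1\equiv1$ on $V$ and $m_2\equiv1$ on $E$. Let $\omega(t,e)$ be the solution of the Ricci flow $$\frac{d}{dt}\omega(t,e)=-\kappa_\omega(t,e)\,\omega(t,e),\quad t>0,\ e\in E,\qquad \omega(0,e)=\omega_0(e),$$ with positive initial value $\omega_0:E\to(0,\infty)$, where $\kappa_\omega$ is the weighted Lin-Lu-Yau curvature. Then, as $t\to\infty$: 1. If $T$ is a path, then $\omega(t,e)$ converges to $0$ for every $e\in E$, and the curvatures $\kappa_\omega(t,e)$, $e\in E$, all converge to one and the same positive constant. 2. If $T=K_{1,3}$, then $\omega(t,e)$ converges to a nonzero real number for every $e\in E$, and $\kappa_\omega(t,e)$ converges to $0$ for every $e\in E$. 3. If $\max_{x\in V}d(x)\ge3$ and $T$ is not $K_{1,3}$, then $\omega(t,e)$ diverges to infinity for every $e\in E$, and the curvatures $\kappa_\omega(t,e)$, $e\in E$, all converge to one and the same negative constant.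
   Context: Write $x\sim y$ if $(x,y)\in E$; $d(x)=\#\{y\in V:y\sim x\}$ is the number of neighbours of $x$. $K_{1,3}$ is the star with three edges. For a weight $\omega:E\to(0,\infty)$, $d_\omega(u,v)=\inf\{\sum_{k=1}^n\omega(v_{k-1},v_k): u=v_0\sim v_1\sim\cdots\sim v_n=v\}$. For vertex and edge measures $m_1,m_2$, let $\operatorname{Deg}(x)=\frac{1}{m_1(x)}\sum_{y\sim x}m_2(x,y)$. For small $\epsilon>0$ let $m_x^\epsilon$ be the probability measure on $V$ with $m_x^\epsilon(x)=1-\epsilon\operatorname{Deg}(x)$, $m_x^\epsilon(y)=\epsilon\, m_2(x,y)/m_1(x)$ for $y\sim x$, and $m_x^\epsilon(y)=0$ otherwise. (Here $m_1=m_2\equiv1$, so $\operatorname{Deg}(x)=d(x)$ and $m_x^\epsilon(y)=\epsilon$ for $y\sim x$.) The weighted Lin-Lu-Yau curvature of $e=(x,y)\in E$ is $$\kappa_\omega(e)=\lim_{\epsilon\to0^+}\frac1\epsilon\Big(1-\frac{W(m_x^\epsilon,m_y^\epsilon)}{d_\omega(x,y)}\Big),$$ where $W(m_x^\epsilon,m_y^\epsilon)=\inf_A\sum_{u,v\in V}d_\omega(u,v)A(u,v)$ is the Wasserstein distance with respect to $d_\omega$, the infimum being over all couplings $A$ of $m_x^\epsilon$ and $m_y^\epsilon$. $\kappa_\omega(t,e)$ denotes the curvature computed with the weight $\omega(t,\cdot)$. *)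

theory Defs
  imports Complex_Main
begin

text \<open>
  Finite simple graphs are given by a vertex set \<open>V\<close> and a set \<open>E\<close> of two-element subsets of
  \<open>V\<close>; \<open>x \<sim> y\<close> is \<open>{x, y} \<in> E\<close>. Edge weights and edge measures are functions on unordered pairs,
  hence symmetric, and only their values on \<open>E\<close> matter.
\<close>

definition simple_graph :: "'a set \<Rightarrow> 'a set set \<Rightarrow> bool" where
  "simple_graph V E \<longleftrightarrow>
     finite V \<and> (\<forall>e\<in>E. \<exists>x\<in>V. \<exists>y\<in>V. x \<noteq> y \<and> e = {x, y})"

definition walk :: "'a set \<Rightarrow> 'a set set \<Rightarrow> 'a list \<Rightarrow> bool" where
  "walk V E p \<longleftrightarrow> p \<noteq> [] \<and> set p \<subseteq> V \<and> successively (\<lambda>x y. {x, y} \<in> E) p"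

definition connected_graph :: "'a set \<Rightarrow> 'a set set \<Rightarrow> bool" where
  "connected_graph V E \<longleftrightarrow>
     V \<noteq> {} \<and> (\<forall>u\<in>V. \<forall>v\<in>V. \<exists>p. walk V E p \<and> hd p = u \<and> last p = v)"

definition graph_cycle :: "'a set \<Rightarrow> 'a set set \<Rightarrow> 'a list \<Rightarrow> bool" where
  "graph_cycle V E p \<longleftrightarrow> walk V E p \<and> distinct p \<and> 3 \<le> length p \<and> {last p, hd p} \<in> E"

definition finite_tree :: "'a set \<Rightarrow> 'a set set \<Rightarrow> bool" where
  "finite_tree V E \<longleftrightarrow>
     simple_graph V E \<and> connected_graph V E \<and> \<not> (\<exists>p. graph_cycle V E p)"

definition is_path :: "'a set \<Rightarrow> 'a set set \<Rightarrow> bool" where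
  "is_path V E \<longleftrightarrow>
     (\<exists>p. p \<noteq> [] \<and> distinct p \<and> V = set p \<and> E = {{p ! i, p ! Suc i} | i. Suc i < length p})"

definition is_K13 :: "'a set \<Rightarrow> 'a set set \<Rightarrow> bool" where
  "is_K13 V E \<longleftrightarrow>
     (\<exists>c x y z. distinct [c, x, y, z] \<and> V = {c, x, y, z} \<and> E = {{c, x}, {c, y}, {c, z}})"

definition vertex_degree :: "'a set \<Rightarrow> 'a set set \<Rightarrow> 'a \<Rightarrow> nat" where
  "vertex_degree V E x = card {y \<in> V. {x, y} \<in> E}"

text \<open>The one-vertex walk is allowed, so that \<open>d\<^sub>\<omega>(u, u) = 0\<close>.\<close>

definition weighted_dist :: "'a set \<Rightarrow> 'a set set \<Rightarrow> ('a set \<Rightarrow> real) \<Rightarrow> 'a \<Rightarrow> 'a \<Rightarrow> real" where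
  "weighted_dist V E \<omega> u v =
     Inf {\<Sum>k=1..<length p. \<omega> {p ! (k - 1), p ! k} | p. walk V E p \<and> hd p = u \<and> last p = v}"

definition weighted_deg ::
    "'a set \<Rightarrow> 'a set set \<Rightarrow> ('a \<Rightarrow> real) \<Rightarrow> ('a set \<Rightarrow> real) \<Rightarrow> 'a \<Rightarrow> real" where
  "weighted_deg V E m1 m2 x = 1 / m1 x * (\<Sum>y\<in>{y \<in> V. {x, y} \<in> E}. m2 {x, y})"

definition walk_measure ::
    "'a set \<Rightarrow> 'a set set \<Rightarrow> ('a \<Rightarrow> real) \<Rightarrow> ('a set \<Rightarrow> real) \<Rightarrow> real \<Rightarrow> 'a \<Rightarrow> 'a \<Rightarrow> real" where
  "walk_measure V E m1 m2 \<epsilon> x y =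
     (if y = x then 1 - \<epsilon> * weighted_deg V E m1 m2 x
      else if {x, y} \<in> E then \<epsilon> * m2 {x, y} / m1 x
      else 0)"

definition coupling :: "'a set \<Rightarrow> ('a \<Rightarrow> real) \<Rightarrow> ('a \<Rightarrow> real) \<Rightarrow> ('a \<Rightarrow> 'a \<Rightarrow> real) \<Rightarrow> bool" where
  "coupling V \<mu> \<nu> A \<longleftrightarrow>
     (\<forall>u\<in>V. \<forall>v\<in>V. 0 \<le> A u v) \<and>
     (\<forall>u\<in>V. (\<Sum>v\<in>V. A u v) = \<mu> u) \<and>
     (\<forall>v\<in>V. (\<Sum>u\<in>V. A u v) = \<nu> v)"

definition wasserstein ::
    "'a set \<Rightarrow> 'a set set \<Rightarrow> ('a set \<Rightarrow> real) \<Rightarrow> ('a \<Rightarrow> real) \<Rightarrow> ('a \<Rightarrow> real) \<Rightarrow> real" where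
  "wasserstein V E \<omega> \<mu> \<nu> =
     Inf {\<Sum>u\<in>V. \<Sum>v\<in>V. weighted_dist V E \<omega> u v * A u v | A. coupling V \<mu> \<nu> A}"

text \<open>
  The curvature of the edge \<open>{x, y}\<close>, written with its two endpoints as arguments; it is
  symmetric in \<open>x\<close> and \<open>y\<close>.
\<close>

definition lly_curvature ::
    "'a set \<Rightarrow> 'a set set \<Rightarrow> ('a \<Rightarrow> real) \<Rightarrow> ('a set \<Rightarrow> real) \<Rightarrow> ('a set \<Rightarrow> real) \<Rightarrow> 'a \<Rightarrow> 'a \<Rightarrow> real"
  where
  "lly_curvature V E m1 m2 \<omega> x y =
     Lim (at_right 0) (\<lambda>\<epsilon>. 1 / \<epsilon> *
       (1 - wasserstein V E \<omega> (walk_measure V E m1 m2 \<epsilon> x) (walk_measure V E m1 m2 \<epsilon> y)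
            / weighted_dist V E \<omega> x y))"

text \<open>
  Solutions are global in time and stay in the set of (positive) weights; since the equation is
  imposed only for \<open>t > 0\<close>, continuity up to \<open>t = 0\<close> links it with the initial value.
\<close>

definition ricci_flow ::
    "'a set \<Rightarrow> 'a set set \<Rightarrow> ('a \<Rightarrow> real) \<Rightarrow> ('a set \<Rightarrow> real) \<Rightarrow> ('a set \<Rightarrow> real) \<Rightarrow>
     (real \<Rightarrow> 'a set \<Rightarrow> real) \<Rightarrow> bool" where
  "ricci_flow V E m1 m2 \<omega>0 \<omega> \<longleftrightarrow>
     (\<forall>t\<ge>0. \<forall>e\<in>E. 0 < \<omega> t e) \<and>
     (\<forall>e\<in>E. \<omega> 0 e = \<omega>0 e) \<and>
     (\<forall>e\<in>E. continuous_on {0..} (\<lambda>t. \<omega> t e)) \<and>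
     (\<forall>t>0. \<forall>x y. {x, y} \<in> E \<longrightarrow>
        ((\<lambda>s. \<omega> s {x, y}) has_real_derivative
           - lly_curvature V E m1 m2 (\<omega> t) x y * \<omega> t {x, y}) (at t))"

end

theory Submission
  imports Defs "HOL-Analysis.Analysis"
begin

text \<open>
  On a tree the optimal transport between the two walk measures is explicit and gives
  \<open>\<kappa>(e) = 2 - (\<Sum>e' adjacent to e. \<omega>(e')) / \<omega>(e)\<close>. The Ricci flow is therefore the linear equation
  \<open>\<omega>' = (A - 2) \<omega>\<close>, where \<open>A\<close> is the adjacency matrix of the line graph. As \<open>A\<close> is symmetric,
  nonnegative and irreducible, it has a positive eigenvector \<open>v\<close> for its largest eigenvalue \<open>\<rho>\<close>, and
  a spectral gap on the orthogonal complement of \<open>v\<close> gives \<open>exp (- (\<rho> - 2) t) \<omega>(t) \<rightarrow> c v\<close> with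
  \<open>c > 0\<close>, hence \<open>\<kappa> \<rightarrow> 2 - \<rho>\<close>. It remains to compare \<open>\<rho>\<close> with \<open>2\<close>: the line graph of a path is a
  path, that of \<open>K\<^sub>1\<^sub>,\<^sub>3\<close> is a triangle, and in the remaining case it properly contains a triangle.
\<close>

subsection \<open>Perron vectors of irreducible symmetric matrices\<close>

text \<open>Vectors indexed by \<open>I\<close> are functions on the whole type \<open>'b\<close>.
  Forcing them to vanish off \<open>I\<close> puts the sphere inside a product of the compact
  factors [-1,1] and {0}, so Tychonoff's theorem applies even if \<open>'b\<close> is
  infinite.\<close>

lemma compact_unit_sphere_supported:
  assumes "finite I"
  shows "compact {f :: 'b \<Rightarrow> real. (\<forall>i. i \<notin> I \<longrightarrow> f i = 0) \<and> (\<Sum>i\<in>I. (f i)\<^sup>2) = 1}" (is "compact ?K")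
proof -
  let ?B = "PiE UNIV (\<lambda>i. if i \<in> I then {-1..1} else {0::real})"
  have "compactin (product_topology (\<lambda>i. euclidean) UNIV) ?B"
    by (subst compactin_PiE) auto
  then have B: "compact ?B"
    by (metis euclidean_product_topology compactin_euclidean_iff)
  have "closed {f :: 'b \<Rightarrow> real. (\<Sum>i\<in>I. (f i)\<^sup>2) = 1}"
    by (intro closed_Collect_eq continuous_intros continuous_on_product_coordinates)
  moreover have "?K = ?B \<inter> {f. (\<Sum>i\<in>I. (f i)\<^sup>2) = 1}"
  proof -
    have "f i \<in> {-1..1}" if "(\<Sum>i\<in>I. (f i)\<^sup>2) = 1" "i \<in> I" for f :: "'b \<Rightarrow> real" and i
    proof -
      have "(f i)\<^sup>2 \<le> 1"
        using member_le_sum[of i I "\<lambda>i. (f i)\<^sup>2"] that assms by auto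
      then show ?thesis by (auto simp: abs_square_le_1 abs_le_iff)
    qed
    then show ?thesis
      by (intro set_eqI) (simp add: PiE_iff split: if_splits, blast)
  qed
  ultimately show ?thesis using B by (simp add: compact_Int_closed)
qed

text \<open>By homogeneity it suffices to maximise over unit vectors, which form a compact set. The
  cone condition constrains \<open>g\<close> on \<open>I\<close> only, so that rescaling and
  truncating to \<open>I\<close> can be done at once. The lemma serves for the nonnegative vectors
  and for the orthogonal complement of the Perron vector.\<close>

lemma quadratic_form_max_on_cone:
  fixes a :: "'b \<Rightarrow> 'b \<Rightarrow> real" and C :: "('b \<Rightarrow> real) set"
  assumes I: "finite I" and C: "closed C"
    and cone: "\<And>f g s. f \<in> C \<Longrightarrow> s > 0 \<Longrightarrow> (\<And>i. i \<in> I \<Longrightarrow> g i = s * f i) \<Longrightarrow> g \<in> C"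
    and h: "h \<in> C" "(\<Sum>i\<in>I. (h i)\<^sup>2) \<noteq> 0"
  obtains v where "v \<in> C" "(\<Sum>i\<in>I. (v i)\<^sup>2) = 1"
    "\<And>f. f \<in> C \<Longrightarrow> (\<Sum>i\<in>I. \<Sum>j\<in>I. a i j * f i * f j)
        \<le> (\<Sum>i\<in>I. \<Sum>j\<in>I. a i j * v i * v j) * (\<Sum>i\<in>I. (f i)\<^sup>2)"
proof -
  define Q where "Q f = (\<Sum>i\<in>I. \<Sum>j\<in>I. a i j * f i * f j)" for f :: "'b \<Rightarrow> real"
  define K where "K = C \<inter> {f :: 'b \<Rightarrow> real. (\<forall>i. i \<notin> I \<longrightarrow> f i = 0) \<and> (\<Sum>i\<in>I. (f i)\<^sup>2) = 1}"
  define N where "N f = (\<lambda>i. if i \<in> I then f i / sqrt (\<Sum>i\<in>I. (f i)\<^sup>2) else 0)" for f :: "'b \<Rightarrow> real"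
  have NK: "N f \<in> K" and QN: "Q f = Q (N f) * (\<Sum>i\<in>I. (f i)\<^sup>2)"
    if f: "f \<in> C" "(\<Sum>i\<in>I. (f i)\<^sup>2) \<noteq> 0" for f
  proof -
    have pos: "(\<Sum>i\<in>I. (f i)\<^sup>2) > 0"
      using f(2) by (metis less_eq_real_def sum_nonneg zero_le_power2)
    have "N f \<in> C"
      using pos by (intro cone[OF f(1), of "1 / sqrt (\<Sum>i\<in>I. (f i)\<^sup>2)"]) (auto simp: N_def)
    moreover have "(\<Sum>i\<in>I. (N f i)\<^sup>2) = 1"
      using pos by (simp add: N_def power_divide sum_nonneg flip: sum_divide_distrib)
    ultimately show "N f \<in> K" by (auto simp: K_def N_def)
    have "Q (N f) = (\<Sum>i\<in>I. \<Sum>j\<in>I. a i j * f i * f j / (\<Sum>i\<in>I. (f i)\<^sup>2))"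
      using pos unfolding Q_def N_def by (intro sum.cong refl) (simp add: sum_nonneg)
    also have "\<dots> = Q f / (\<Sum>i\<in>I. (f i)\<^sup>2)"
      by (simp add: Q_def sum_divide_distrib)
    finally show "Q f = Q (N f) * (\<Sum>i\<in>I. (f i)\<^sup>2)" using pos by simp
  qed
  have "compact K"
    unfolding K_def by (intro closed_Int_compact C compact_unit_sphere_supported I)
  moreover have "K \<noteq> {}" using NK h by auto
  moreover have "continuous_on K Q"
    unfolding Q_def
    by (intro continuous_intros continuous_on_subset[OF continuous_on_product_coordinates]) auto
  ultimately obtain v where v: "v \<in> K" "\<And>f. f \<in> K \<Longrightarrow> Q f \<le> Q v"
    using continuous_attains_sup by metis
  show thesis
  proof (rule that[of v])
    fix f assume f: "f \<in> C"
    show "(\<Sum>i\<in>I. \<Sum>j\<in>I. a i j * f i * f j)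
        \<le> (\<Sum>i\<in>I. \<Sum>j\<in>I. a i j * v i * v j) * (\<Sum>i\<in>I. (f i)\<^sup>2)"
    proof (cases "(\<Sum>i\<in>I. (f i)\<^sup>2) = 0")
      case True
      then have "f i = 0" if "i \<in> I" for i
        using that I by (simp add: sum_nonneg_eq_0_iff)
      then show ?thesis by simp
    next
      case False
      then show ?thesis
        using QN[OF f False] v(2)[OF NK[OF f False]] unfolding Q_def[symmetric]
        by (simp add: mult_right_mono sum_nonneg)
    qed
  qed (use v in \<open>auto simp: K_def\<close>)
qed

text \<open>Irreducibility is phrased through sets closed under passing to neighbours, the form in
  which it is applied to zero sets and level sets.\<close>

locale irreducible_symmetric =
  fixes I :: "'b set" and a :: "'b \<Rightarrow> 'b \<Rightarrow> real"
  assumes fin: "finite I" and ne: "I \<noteq> {}"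
    and sym: "\<And>i j. a i j = a j i" and nonneg: "\<And>i j. a i j \<ge> 0"
    and irreducible: "\<And>S. S \<subseteq> I \<Longrightarrow> S \<noteq> {} \<Longrightarrow>
      (\<And>i j. i \<in> S \<Longrightarrow> j \<in> I \<Longrightarrow> a i j > 0 \<Longrightarrow> j \<in> S) \<Longrightarrow> S = I"
begin

text \<open>Maximising the quadratic form over nonnegative vectors only makes the maximiser
  nonnegative from the start; irreducibility then upgrades this to positivity.\<close>

lemma perron_vector:
  obtains v \<rho> where "\<And>i. i \<in> I \<Longrightarrow> v i > 0"
    "\<And>i. i \<in> I \<Longrightarrow> (\<Sum>j\<in>I. a i j * v j) = \<rho> * v i" "(\<Sum>i\<in>I. (v i)\<^sup>2) = 1"
proof -
  define Q where "Q f = (\<Sum>i\<in>I. \<Sum>j\<in>I. a i j * f i * f j)" for f :: "'b \<Rightarrow> real"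
  define A where "A f i = (\<Sum>j\<in>I. a i j * f j)" for f :: "'b \<Rightarrow> real" and i
  define C where "C = {f :: 'b \<Rightarrow> real. \<forall>i\<in>I. 0 \<le> f i}"
  have C_Int: "C = (\<Inter>i\<in>I. {f. 0 \<le> f i})" by (auto simp: C_def)
  have "closed {f :: 'b \<Rightarrow> real. 0 \<le> f i}" for i
    by (intro closed_Collect_le continuous_intros continuous_on_product_coordinates)
  then have "closed C" unfolding C_Int by blast
  then obtain v where v: "v \<in> C" "(\<Sum>i\<in>I. (v i)\<^sup>2) = 1"
    and max: "\<And>f. f \<in> C \<Longrightarrow> Q f \<le> Q v * (\<Sum>i\<in>I. (f i)\<^sup>2)"
    unfolding Q_def
    by (rule quadratic_form_max_on_cone[OF fin, where h = "\<lambda>_. 1" and a = a])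
      (use fin ne in \<open>auto simp: C_def\<close>)
  define \<rho> where "\<rho> = Q v"
  have v0: "v i \<ge> 0" if "i \<in> I" for i using v that by (auto simp: C_def)
  \<comment> \<open>Maximality is tested only against the perturbations \<open>v + s \<delta>\<^sub>i\<close> with \<open>s > 0\<close>, which stay nonnegative.
    The resulting inequality is an equality because its \<open>v\<close>-weighted sum vanishes.\<close>
  have le: "A v i \<le> \<rho> * v i" if i: "i \<in> I" for i
  proof -
    have *: "2 * A v i + s * a i i \<le> 2 * \<rho> * v i + s * \<rho>" if s: "s > 0" for s
    proof -
      define f where "f j = v j + (if j = i then s else 0)" for j
      have "f \<in> C" using v s by (auto simp: f_def C_def)
      have "(\<Sum>j\<in>I. (f j)\<^sup>2) = (\<Sum>j\<in>I. (v j)\<^sup>2 + (if j = i then 2 * s * v i + s\<^sup>2 else 0))"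
        by (intro sum.cong) (auto simp: f_def power2_sum)
      then have nf: "(\<Sum>j\<in>I. (f j)\<^sup>2) = 1 + 2 * s * v i + s\<^sup>2"
        using i fin v by (simp add: sum.distrib)
      have Af: "A f k = A v k + a k i * s" for k
      proof -
        have "A f k = (\<Sum>j\<in>I. a k j * v j + (if j = i then a k i * s else 0))"
          unfolding A_def f_def by (intro sum.cong refl) (auto simp: distrib_left)
        then show ?thesis using i fin by (simp add: A_def sum.distrib)
      qed
      have QA: "Q g = (\<Sum>k\<in>I. g k * A g k)" for g
        by (simp add: Q_def A_def sum_distrib_left mult_ac)
      have "Q f = (\<Sum>k\<in>I. v k * A v k + s * (a i k * v k) + (if k = i then s * (A v k + a k i * s) else 0))"
        unfolding QA Af by (intro sum.cong refl) (auto simp: f_def algebra_simps sym)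
      also have "\<dots> = Q v + s * A v i + s * (A v i + a i i * s)"
        using i fin by (simp add: sum.distrib QA A_def sum_distrib_left)
      finally have "\<rho> + s * A v i + s * (A v i + a i i * s) \<le> \<rho> * (1 + 2 * s * v i + s\<^sup>2)"
        using max[OF \<open>f \<in> C\<close>] nf by (simp add: \<rho>_def)
      \<comment> \<open>The terms of order zero in \<open>s\<close> cancel. After division by
        \<open>s\<close>, the limit as \<open>s\<close> tends to 0 gives the first-order
        condition.\<close>
      then have "s * (2 * A v i + s * a i i) \<le> s * (2 * \<rho> * v i + s * \<rho>)"
        by (simp add: algebra_simps power2_eq_square)
      then show ?thesis using s by simp
    qed
    have "2 * A v i \<le> 2 * \<rho> * v i"
    proof (rule tendsto_le[of "at_right 0"])
      show "((\<lambda>s. 2 * A v i + s * a i i) \<longlongrightarrow> 2 * A v i) (at_right 0)"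
        by (auto intro!: tendsto_eq_intros)
      show "((\<lambda>s. 2 * \<rho> * v i + s * \<rho>) \<longlongrightarrow> 2 * \<rho> * v i) (at_right 0)"
        by (auto intro!: tendsto_eq_intros)
      show "\<forall>\<^sub>F s in at_right 0. 2 * A v i + s * a i i \<le> 2 * \<rho> * v i + s * \<rho>"
        using * by (auto simp: eventually_at_right_field intro: exI[of _ 1])
    qed auto
    then show ?thesis by simp
  qed
  have "(\<Sum>i\<in>I. v i * (\<rho> * v i - A v i)) = \<rho> * (\<Sum>i\<in>I. (v i)\<^sup>2) - Q v"
    by (simp add: Q_def A_def sum_distrib_left algebra_simps sum_subtractf power2_eq_square)
  then have "(\<Sum>i\<in>I. v i * (\<rho> * v i - A v i)) = 0" using v by (simp add: \<rho>_def)
  moreover have "0 \<le> v i * (\<rho> * v i - A v i)" if "i \<in> I" for i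
    using le v0 that by simp
  ultimately have zero: "v i * (\<rho> * v i - A v i) = 0" if "i \<in> I" for i
    using sum_nonneg_eq_0_iff[OF fin, of "\<lambda>i. v i * (\<rho> * v i - A v i)"] that by blast
  have A0: "0 \<le> A v i" for i
    unfolding A_def by (intro sum_nonneg mult_nonneg_nonneg nonneg v0)
  \<comment> \<open>At a zero of \<open>v\<close> the product equation says nothing, but there
    \<open>A v i\<close> is squeezed between 0 and \<open>\<rho> * 0\<close>.\<close>
  have eig: "A v i = \<rho> * v i" if "i \<in> I" for i
    using zero[OF that] le[OF that] A0[of i] by (cases "v i = 0") auto
  have pos: "v i > 0" if "i \<in> I" for i
  proof (rule ccontr)
    assume n: "\<not> v i > 0"
    \<comment> \<open>At a zero of \<open>v\<close> the eigenvalue equation is a vanishing sum of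
      nonnegative terms, so \<open>v\<close> vanishes at all neighbours too.\<close>
    have "{i \<in> I. v i = 0} = I"
    proof (rule irreducible)
      show "{i \<in> I. v i = 0} \<noteq> {}" using n that v0[OF that] by force
      fix k j assume k: "k \<in> {i \<in> I. v i = 0}" and j: "j \<in> I" "a k j > 0"
      then have "(\<Sum>j\<in>I. a k j * v j) = 0" using eig[of k] by (simp add: A_def)
      moreover have "\<forall>j\<in>I. 0 \<le> a k j * v j" using v0 nonneg by simp
      ultimately have "a k j * v j = 0"
        using sum_nonneg_eq_0_iff[OF fin, of "\<lambda>j. a k j * v j"] j by blast
      then show "j \<in> {i \<in> I. v i = 0}" using j by auto
    qed auto
    then have "(\<Sum>i\<in>I. (v i)\<^sup>2) = 0" by (intro sum.neutral) auto
    then show False using v by simp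
  qed
  show thesis using that[of v \<rho>] pos eig v by (simp add: A_def)
qed

section \<open>Spectral gap and convergence of the linear flow\<close>

context
  fixes v :: "'b \<Rightarrow> real" and \<rho> :: real
  assumes v_pos: "\<And>i. i \<in> I \<Longrightarrow> v i > 0"
    and eigen: "\<And>i. i \<in> I \<Longrightarrow> (\<Sum>j\<in>I. a i j * v j) = \<rho> * v i"
begin

text \<open>Ground state transform: in terms of the quotients \<open>g i / v i\<close>, the form of
  \<open>\<rho>\<close> minus the matrix becomes a Dirichlet form with nonnegative weights
  \<open>a i j * v i * v j\<close>. When the square is expanded, the two pure square terms agree by
  symmetry and collapse by the eigenvalue equation.\<close>

lemma ground_state_identity:
  "(\<Sum>i\<in>I. \<Sum>j\<in>I. a i j * v i * v j * (g i / v i - g j / v j)\<^sup>2)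
    = 2 * (\<rho> * (\<Sum>i\<in>I. (g i)\<^sup>2) - (\<Sum>i\<in>I. \<Sum>j\<in>I. a i j * g i * g j))"
proof -
  have "a i j * v i * v j * (g i / v i - g j / v j)\<^sup>2 =
      (g i)\<^sup>2 / v i * (a i j * v j) + (g j)\<^sup>2 / v j * (a j i * v i) - 2 * (a i j * g i * g j)"
    if "i \<in> I" "j \<in> I" for i j
    using v_pos[OF that(1)] v_pos[OF that(2)]
    by (simp add: sym[of j i] power2_eq_square field_simps)
  then have "(\<Sum>i\<in>I. \<Sum>j\<in>I. a i j * v i * v j * (g i / v i - g j / v j)\<^sup>2) =
    (\<Sum>i\<in>I. \<Sum>j\<in>I. (g i)\<^sup>2 / v i * (a i j * v j)) + (\<Sum>i\<in>I. \<Sum>j\<in>I. (g j)\<^sup>2 / v j * (a j i * v i))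
    - 2 * (\<Sum>i\<in>I. \<Sum>j\<in>I. a i j * g i * g j)"
    by (simp add: sum.distrib sum_subtractf sum_distrib_left)
  also have "(\<Sum>i\<in>I. \<Sum>j\<in>I. (g j)\<^sup>2 / v j * (a j i * v i)) = (\<Sum>i\<in>I. \<Sum>j\<in>I. (g i)\<^sup>2 / v i * (a i j * v j))"
    by (rule sum.swap)
  also have "(\<Sum>i\<in>I. \<Sum>j\<in>I. (g i)\<^sup>2 / v i * (a i j * v j)) = \<rho> * (\<Sum>i\<in>I. (g i)\<^sup>2)"
  proof -
    have "(\<Sum>j\<in>I. (g i)\<^sup>2 / v i * (a i j * v j)) = \<rho> * (g i)\<^sup>2" if "i \<in> I" for i
      unfolding sum_distrib_left[symmetric] eigen[OF that] using v_pos[OF that] by simp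
    then show ?thesis by (simp add: sum_distrib_left)
  qed
  finally show ?thesis by simp
qed

text \<open>The maximum \<open>M\<close> of the form over unit vectors orthogonal to
  \<open>v\<close> is attained. If it were \<open>\<rho>\<close>, the Dirichlet form of the
  maximiser would vanish, so by irreducibility the maximiser would be a multiple of
  \<open>v\<close>, contradicting orthogonality. Hence \<open>\<rho> - M\<close> is a gap.\<close>

lemma spectral_gap:
  obtains \<gamma> where "\<gamma> > 0" "\<And>g. (\<Sum>i\<in>I. v i * g i) = 0 \<Longrightarrow>
     (\<Sum>i\<in>I. \<Sum>j\<in>I. a i j * g i * g j) \<le> (\<rho> - \<gamma>) * (\<Sum>i\<in>I. (g i)\<^sup>2)"
proof (cases "\<exists>f. (\<Sum>i\<in>I. v i * f i) = 0 \<and> (\<Sum>i\<in>I. (f i)\<^sup>2) \<noteq> 0")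
  \<comment> \<open>Only the zero vector on \<open>I\<close> is orthogonal to \<open>v\<close>,
    which happens when \<open>I\<close> is a singleton; any positive \<open>\<gamma>\<close> will
    do.\<close>
  case False
  have "(\<Sum>i\<in>I. \<Sum>j\<in>I. a i j * g i * g j) \<le> (\<rho> - 1) * (\<Sum>i\<in>I. (g i)\<^sup>2)"
    if "(\<Sum>i\<in>I. v i * g i) = 0" for g
  proof -
    have z: "(\<Sum>i\<in>I. (g i)\<^sup>2) = 0" using False that by auto
    then have "g i = 0" if "i \<in> I" for i
      using that fin by (simp add: sum_nonneg_eq_0_iff)
    then show ?thesis using z by simp
  qed
  then show thesis by (intro that[of 1]) auto
next
  case True
  define C where "C = {f :: 'b \<Rightarrow> real. (\<Sum>i\<in>I. v i * f i) = 0}"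
  have C: "closed C"
    unfolding C_def
    by (intro closed_Collect_eq continuous_intros continuous_on_product_coordinates)
  have cone: "h \<in> C" if "f \<in> C" "s > 0" "\<And>i. i \<in> I \<Longrightarrow> h i = s * f i" for f h and s :: real
  proof -
    have "(\<Sum>i\<in>I. v i * h i) = s * (\<Sum>i\<in>I. v i * f i)"
      using that by (simp add: sum_distrib_left mult_ac)
    then show ?thesis using that by (simp add: C_def)
  qed
  obtain f0 where f0: "f0 \<in> C" "(\<Sum>i\<in>I. (f0 i)\<^sup>2) \<noteq> 0" using True by (auto simp: C_def)
  obtain g where g: "g \<in> C" and g1: "(\<Sum>i\<in>I. (g i)\<^sup>2) = 1"
    and max: "\<And>f. f \<in> C \<Longrightarrow> (\<Sum>i\<in>I. \<Sum>j\<in>I. a i j * f i * f j)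
        \<le> (\<Sum>i\<in>I. \<Sum>j\<in>I. a i j * g i * g j) * (\<Sum>i\<in>I. (f i)\<^sup>2)"
    by (rule quadratic_form_max_on_cone[OF fin C cone f0, where a = a]) auto
  define M where "M = (\<Sum>i\<in>I. \<Sum>j\<in>I. a i j * g i * g j)"
  let ?D = "\<lambda>i j. a i j * v i * v j * (g i / v i - g j / v j)\<^sup>2"
  have D0: "?D i j \<ge> 0" if "i \<in> I" "j \<in> I" for i j
    using nonneg[of i j] v_pos that by (simp add: less_imp_le)
  have D: "(\<Sum>i\<in>I. \<Sum>j\<in>I. ?D i j) = 2 * (\<rho> - M)"
    using ground_state_identity[of g] g1 by (simp add: M_def)
  have "M \<noteq> \<rho>"
  proof
    assume "M = \<rho>"
    then have "(\<Sum>i\<in>I. \<Sum>j\<in>I. ?D i j) = 0" using D by simp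
    moreover have "0 \<le> (\<Sum>j\<in>I. ?D i j)" if "i \<in> I" for i
      by (intro sum_nonneg D0 that)
    ultimately have row: "(\<Sum>j\<in>I. ?D i j) = 0" if "i \<in> I" for i
      using sum_nonneg_eq_0_iff[OF fin, of "\<lambda>i. \<Sum>j\<in>I. ?D i j"] that by blast
    have Dz: "?D i j = 0" if "i \<in> I" "j \<in> I" for i j
      using sum_nonneg_eq_0_iff[OF fin, of "?D i"] D0 row that by blast
    obtain k where k: "k \<in> I" using ne by auto
    have "{i \<in> I. g i / v i = g k / v k} = I"
    proof (rule irreducible)
      fix i j assume i: "i \<in> {i \<in> I. g i / v i = g k / v k}" and j: "j \<in> I" "a i j > 0"
      then have "v i > 0" "v j > 0" using v_pos by auto
      then have "g i / v i = g j / v j" using Dz[of i j] i j(1) j(2) by auto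
      then show "j \<in> {i \<in> I. g i / v i = g k / v k}" using i j by auto
    qed (use k in auto)
    then have gk: "g i = (g k / v k) * v i" if "i \<in> I" for i
    proof -
      have "g i / v i = g k / v k" using \<open>_ = I\<close> that by blast
      then show ?thesis using v_pos[OF that] by (simp add: divide_eq_eq)
    qed
    have "(\<Sum>i\<in>I. v i * g i) = (g k / v k) * (\<Sum>i\<in>I. (v i)\<^sup>2)"
      unfolding sum_distrib_left by (intro sum.cong refl) (subst gk, auto simp: power2_eq_square)
    moreover have "(\<Sum>i\<in>I. (v i)\<^sup>2) > 0"
      using fin ne v_pos by (intro sum_pos) (auto simp: less_imp_neq[symmetric])
    ultimately have "g k / v k = 0" using g by (auto simp: C_def)
    then have "g i = 0" if "i \<in> I" for i using gk[OF that] by (simp only: mult_zero_left)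
    then show False using g1 by simp
  qed
  moreover have "M \<le> \<rho>"
  proof -
    have "0 \<le> (\<Sum>i\<in>I. \<Sum>j\<in>I. ?D i j)" by (intro sum_nonneg D0)
    then show ?thesis using D by simp
  qed
  ultimately have "\<rho> - M > 0" by simp
  then show thesis
    by (rule that) (use max in \<open>simp add: M_def C_def\<close>)
qed

text \<open>The component of \<open>u\<close> along \<open>v\<close> is conserved, because the
  matrix is symmetric and \<open>v\<close> is stationary. The rest stays orthogonal to
  \<open>v\<close>, and the spectral gap makes its norm decay exponentially.\<close>

lemma normalized_flow_converges:
  fixes u :: "real \<Rightarrow> 'b \<Rightarrow> real"
  assumes unit: "(\<Sum>i\<in>I. (v i)\<^sup>2) = 1"
    and der: "\<And>t i. t > 0 \<Longrightarrow> i \<in> I \<Longrightarrow>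
      ((\<lambda>s. u s i) has_real_derivative (\<Sum>j\<in>I. a i j * u t j) - \<rho> * u t i) (at t)"
    and i: "i \<in> I"
  shows "((\<lambda>t. u t i) \<longlongrightarrow> (\<Sum>j\<in>I. v j * u 1 j) * v i) at_top"
proof -
  have selfadj: "(\<Sum>i\<in>I. f i * (\<Sum>j\<in>I. a i j * g j)) = (\<Sum>i\<in>I. g i * (\<Sum>j\<in>I. a i j * f j))" for f g
  proof -
    have "(\<Sum>i\<in>I. f i * (\<Sum>j\<in>I. a i j * g j)) = (\<Sum>i\<in>I. \<Sum>j\<in>I. f i * (a i j * g j))"
      by (simp only: sum_distrib_left)
    also have "\<dots> = (\<Sum>j\<in>I. \<Sum>i\<in>I. f i * (a i j * g j))" by (rule sum.swap)
    also have "\<dots> = (\<Sum>j\<in>I. \<Sum>i\<in>I. g j * (a j i * f i))"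
      by (intro sum.cong refl) (subst sym, simp only: mult_ac)
    finally show ?thesis by (simp only: sum_distrib_left)
  qed
  \<comment> \<open>The equation is available for positive times only, so time 1 serves as the
    starting point in place of 0.\<close>
  define c where "c = (\<Sum>j\<in>I. v j * u 1 j)"
  have const: "(\<Sum>j\<in>I. v j * u t j) = c" if t: "t \<ge> 1" for t
  proof -
    have "((\<lambda>s. \<Sum>j\<in>I. v j * u s j) has_real_derivative 0) (at s)" if "1 \<le> s" for s
    proof -
      have "((\<lambda>s. \<Sum>j\<in>I. v j * u s j) has_real_derivative
        (\<Sum>i\<in>I. v i * ((\<Sum>j\<in>I. a i j * u s j) - \<rho> * u s i))) (at s)"
        using that by (intro DERIV_sum DERIV_cmult der) auto
      also have "(\<Sum>i\<in>I. v i * ((\<Sum>j\<in>I. a i j * u s j) - \<rho> * u s i)) =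
         (\<Sum>i\<in>I. v i * (\<Sum>j\<in>I. a i j * u s j)) - \<rho> * (\<Sum>i\<in>I. v i * u s i)"
        by (simp add: right_diff_distrib sum_subtractf sum_distrib_left mult_ac)
      also have "\<dots> = 0"
      proof -
        have "(\<Sum>i\<in>I. v i * (\<Sum>j\<in>I. a i j * u s j)) = (\<Sum>i\<in>I. \<rho> * (v i * u s i))"
          unfolding selfadj[of v] by (intro sum.cong refl) (simp add: eigen)
        then show ?thesis by (simp only: sum_distrib_left)
      qed
      finally show ?thesis .
    qed
    then have "\<exists>k. \<forall>s\<in>{1..}. (\<Sum>j\<in>I. v j * u s j) = k"
      by (intro has_field_derivative_zero_constant) (auto intro: has_field_derivative_at_within)
    then show ?thesis using t by (force simp: c_def)
  qed
  define g where "g t i = u t i - c * v i" for t i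
  define F where "F t = (\<Sum>i\<in>I. (g t i)\<^sup>2)" for t
  have perp: "(\<Sum>i\<in>I. v i * g t i) = 0" if "t \<ge> 1" for t
    using const[OF that] unit
    by (simp add: g_def right_diff_distrib sum_subtractf power2_eq_square mult_ac flip: sum_distrib_left)
  obtain \<gamma> where \<gamma>: "\<gamma> > 0" "\<And>g. (\<Sum>i\<in>I. v i * g i) = 0 \<Longrightarrow>
     (\<Sum>i\<in>I. \<Sum>j\<in>I. a i j * g i * g j) \<le> (\<rho> - \<gamma>) * (\<Sum>i\<in>I. (g i)\<^sup>2)"
    using spectral_gap by blast
  have dF: "(F has_real_derivative
      2 * ((\<Sum>i\<in>I. \<Sum>j\<in>I. a i j * g t i * g t j) - \<rho> * F t)) (at t)" if t: "t > 0" for t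
  proof -
    have "((\<lambda>s. g s i) has_real_derivative (\<Sum>j\<in>I. a i j * g t j) - \<rho> * g t i) (at t)"
      if i: "i \<in> I" for i
    proof -
      have "(\<Sum>j\<in>I. a i j * g t j) = (\<Sum>j\<in>I. a i j * u t j) - c * (\<Sum>j\<in>I. a i j * v j)"
        by (simp add: g_def right_diff_distrib sum_subtractf sum_distrib_left mult_ac)
      then have "(\<Sum>j\<in>I. a i j * g t j) - \<rho> * g t i = (\<Sum>j\<in>I. a i j * u t j) - \<rho> * u t i"
        using eigen[OF i] by (simp add: g_def algebra_simps)
      then show ?thesis
        using DERIV_diff[OF der[OF t i] DERIV_const[of "c * v i"]] by (simp add: g_def)
    qed
    then have "(F has_real_derivative
      (\<Sum>i\<in>I. 2 * g t i * ((\<Sum>j\<in>I. a i j * g t j) - \<rho> * g t i))) (at t)"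
      unfolding F_def by (intro DERIV_sum) (auto intro!: derivative_eq_intros)
    also have "(\<Sum>i\<in>I. 2 * g t i * ((\<Sum>j\<in>I. a i j * g t j) - \<rho> * g t i)) =
       2 * ((\<Sum>i\<in>I. \<Sum>j\<in>I. a i j * g t i * g t j) - \<rho> * F t)"
      by (simp add: F_def right_diff_distrib sum_subtractf sum_distrib_left power2_eq_square mult_ac)
    finally show ?thesis .
  qed
  \<comment> \<open>Gronwall's argument with an integrating factor: the gap bounds the derivative of
    \<open>F\<close> by \<open>- 2 * \<gamma> * F\<close>, the factor 2 arising because
    \<open>F\<close> is a squared norm.\<close>
  have decay: "F t * exp (2 * \<gamma> * t) \<le> F 1 * exp (2 * \<gamma>)" if t: "t \<ge> 1" for t
  proof -
    have "F t * exp (2 * \<gamma> * t) \<le> F 1 * exp (2 * \<gamma> * 1)"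
    proof (rule DERIV_nonpos_imp_nonincreasing[OF t])
      fix s :: real assume s: "1 \<le> s"
      have "((\<lambda>s. F s * exp (2 * \<gamma> * s)) has_real_derivative
          (2 * ((\<Sum>i\<in>I. \<Sum>j\<in>I. a i j * g s i * g s j) - (\<rho> - \<gamma>) * F s)) * exp (2 * \<gamma> * s)) (at s)"
        using s by (auto intro!: derivative_eq_intros dF simp: algebra_simps)
      moreover have "(2 * ((\<Sum>i\<in>I. \<Sum>j\<in>I. a i j * g s i * g s j) - (\<rho> - \<gamma>) * F s)) * exp (2 * \<gamma> * s) \<le> 0"
        using \<gamma>(2)[OF perp[OF s]] by (intro mult_nonpos_nonneg[OF mult_nonneg_nonpos]) (simp_all add: F_def)
      ultimately show "\<exists>y. ((\<lambda>s. F s * exp (2 * \<gamma> * s)) has_real_derivative y) (at s) \<and> y \<le> 0"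
        by blast
    qed
    then show ?thesis by simp
  qed
  have lim: "((\<lambda>t. F 1 * exp (2 * \<gamma>) * exp (- (2 * \<gamma> * t))) \<longlongrightarrow> 0) at_top"
      using \<gamma>(1)
    by (intro tendsto_mult_right_zero filterlim_compose[OF exp_at_bot]
          filterlim_uminus_at_bot[THEN iffD2])
      (auto intro!: filterlim_tendsto_pos_mult_at_top[OF tendsto_const] filterlim_ident
        simp: filterlim_uminus_at_bot)
  have le: "\<forall>\<^sub>F t in at_top. (g t i)\<^sup>2 \<le> F 1 * exp (2 * \<gamma>) * exp (- (2 * \<gamma> * t))"
    using eventually_ge_at_top[of 1]
  proof eventually_elim
    case (elim t)
    have "(g t i)\<^sup>2 \<le> F t"
      unfolding F_def using i fin by (intro member_le_sum) auto
    also have "F t \<le> F 1 * exp (2 * \<gamma>) * exp (- (2 * \<gamma> * t))"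
      using decay[OF elim] by (simp add: exp_minus field_simps)
    finally show ?case .
  qed
  have "((\<lambda>t. (g t i)\<^sup>2) \<longlongrightarrow> 0) at_top"
    by (rule tendsto_sandwich[OF _ le tendsto_const lim]) simp
  then have "((\<lambda>t. g t i) \<longlongrightarrow> 0) at_top"
    using tendsto_real_sqrt[of "\<lambda>t. (g t i)\<^sup>2" 0] by (auto simp: tendsto_rabs_zero_iff)
  then have "((\<lambda>t. g t i + c * v i) \<longlongrightarrow> 0 + c * v i) at_top"
    by (intro tendsto_intros)
  then show ?thesis by (simp add: g_def c_def)
qed

end
end

subsection \<open>The curvature of the edges of a tree\<close>

definition walk_weight :: "('a set \<Rightarrow> real) \<Rightarrow> 'a list \<Rightarrow> real" where
  "walk_weight \<omega> p = (\<Sum>k=1..<length p. \<omega> {p ! (k - 1), p ! k})"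

lemma walk_weight_single [simp]: "walk_weight \<omega> [x] = 0"
  by (simp add: walk_weight_def)

lemma walk_weight_Cons [simp]:
  "walk_weight \<omega> (x # y # p) = \<omega> {x, y} + walk_weight \<omega> (y # p)"
proof -
  have "walk_weight \<omega> (x # y # p)
      = \<omega> {x, y} + (\<Sum>k=Suc 1..<Suc (length (y # p)). \<omega> {(x # y # p) ! (k - 1), (x # y # p) ! k})"
    unfolding walk_weight_def by (subst sum.atLeast_Suc_lessThan) auto
  also have "(\<Sum>k=Suc 1..<Suc (length (y # p)). \<omega> {(x # y # p) ! (k - 1), (x # y # p) ! k})
      = walk_weight \<omega> (y # p)"
    unfolding walk_weight_def sum.shift_bounds_Suc_ivl
    by (intro sum.cong refl) (auto simp: nth_Cons')
  finally show ?thesis .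
qed

text \<open>Vertices are prepended one at a time. If the new vertex already occurs, the loop is cut
  out by keeping only the part of the list that starts at its occurrence.\<close>

lemma rtranclp_imp_distinct_list:
  assumes "R\<^sup>*\<^sup>* a b"
  shows "\<exists>p. p \<noteq> [] \<and> distinct p \<and> successively R p \<and> hd p = a \<and> last p = b"
  using assms
proof (induction rule: converse_rtranclp_induct)
  case base
  show ?case by (intro exI[of _ "[b]"]) auto
next
  case (step u w)
  then obtain p where p: "p \<noteq> []" "distinct p" "successively R p" "hd p = w" "last p = b"
    by blast
  show ?case
  proof (cases "u \<in> set p")
    case True
    then obtain q r where "p = q @ u # r" by (meson split_list)
    then show ?thesis
      using p by (intro exI[of _ "u # r"]) (auto simp: successively_append_iff)
  next
    case False
    then show ?thesis
      using p step by (intro exI[of _ "u # p"]) (auto simp: successively_Cons)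
  qed
qed

section \<open>The line graph of a tree and its connectedness\<close>

definition adjacent_edges :: "'a set \<Rightarrow> 'a set \<Rightarrow> bool" where
  "adjacent_edges e e' \<longleftrightarrow> e \<noteq> e' \<and> e \<inter> e' \<noteq> {}"

lemma adjacent_edges_sym: "adjacent_edges e e' \<longleftrightarrow> adjacent_edges e' e"
  by (auto simp: adjacent_edges_def)

lemma finite_tree_edges: "finite_tree V E \<Longrightarrow> finite E"
  by (rule finite_subset[of _ "Pow V"]) (auto simp: finite_tree_def simple_graph_def)

lemma finite_tree_no_isolated_vertex:
  assumes "finite_tree V E" "u \<in> V" "w \<in> V" "u \<noteq> w"
  obtains z where "{u, z} \<in> E"
proof -
  obtain p where p: "walk V E p" "hd p = u" "last p = w"
    using assms unfolding finite_tree_def connected_graph_def by blast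
  then obtain z q where "p = u # z # q"
    using assms(4) by (cases p rule: remdups_adj.cases) (auto simp: walk_def)
  then show thesis using p that[of z] by (simp add: walk_def)
qed

text \<open>A walk that starts at a vertex covered by \<open>S\<close> uses edges of
  \<open>S\<close> only, since each next edge lies in \<open>S\<close> or shares a vertex with an
  edge of \<open>S\<close>. As the tree is connected, such walks reach an endpoint of every
  edge.\<close>

lemma line_graph_connected:
  assumes tree: "finite_tree V E" and S: "S \<subseteq> E" "S \<noteq> {}"
    and closed: "\<And>e e'. e \<in> S \<Longrightarrow> e' \<in> E \<Longrightarrow> adjacent_edges e e' \<Longrightarrow> e' \<in> S"
  shows "S = E"
proof -
  have step: "{u, w} \<in> S" if "u \<in> \<Union>S" "{u, w} \<in> E" for u w
    using that closed by (auto simp: adjacent_edges_def)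
  have reach: "last p \<in> \<Union>S" if "walk V E p" "hd p \<in> \<Union>S" for p
    using that
  proof (induction p rule: induct_list012)
    case (3 u w p)
    then have "{u, w} \<in> S" by (intro step) (auto simp: walk_def)
    then have "w \<in> \<Union>S" by blast
    then show ?case using "3.IH"(2) "3.prems"(1) by (simp add: walk_def)
  qed (auto simp: walk_def)
  obtain e a where a: "e \<in> S" "a \<in> e" "a \<in> V"
    using S tree unfolding finite_tree_def simple_graph_def by blast
  have "e' \<in> S" if e'E: "e' \<in> E" for e'
  proof -
    obtain u w where e': "e' = {u, w}" "u \<in> V"
      using e'E tree unfolding finite_tree_def simple_graph_def by blast
    obtain p where p: "walk V E p" "hd p = a" "last p = u"
      using tree a e' unfolding finite_tree_def connected_graph_def by blast
    have "hd p \<in> \<Union>S" using p a by blast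
    then have "u \<in> \<Union>S" using reach p by blast
    then show ?thesis using step e'E e' by blast
  qed
  then show ?thesis using S by blast
qed

section \<open>Distances and Kantorovich potentials on a weighted tree\<close>

locale weighted_tree =
  fixes V :: "'a set" and E :: "'a set set" and \<omega> :: "'a set \<Rightarrow> real"
  assumes tree: "finite_tree V E" and weight_pos: "\<And>e. e \<in> E \<Longrightarrow> \<omega> e > 0"
begin

definition nbrs :: "'a \<Rightarrow> 'a set" where
  "nbrs x = {y \<in> V. {x, y} \<in> E}"

lemma finite_V: "finite V"
  using tree by (simp add: finite_tree_def simple_graph_def)

lemma finite_nbrs [simp]: "finite (nbrs x)"
  using finite_V by (simp add: nbrs_def)

lemma edgeD: "{x, y} \<in> E \<Longrightarrow> x \<in> V \<and> y \<in> V \<and> x \<noteq> y"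
proof -
  assume "{x, y} \<in> E"
  then obtain u w where "u \<in> V" "w \<in> V" "u \<noteq> w" "{x, y} = {u, w}"
    using tree unfolding finite_tree_def simple_graph_def by blast
  then show ?thesis by (auto simp: doubleton_eq_iff)
qed

lemma mem_nbrs: "y \<in> nbrs x \<longleftrightarrow> {x, y} \<in> E"
  using edgeD by (auto simp: nbrs_def)

lemma walk_weight_nonneg: "walk V E p \<Longrightarrow> walk_weight \<omega> p \<ge> 0"
proof (induction p rule: induct_list012)
  case (3 x y p)
  then show ?case
    using weight_pos[of "{x, y}"] by (auto simp: walk_def)
qed (auto simp: walk_def)

lemma weighted_dist_eq:
  "weighted_dist V E \<omega> u v = Inf (walk_weight \<omega> ` {p. walk V E p \<and> hd p = u \<and> last p = v})"
  by (simp add: weighted_dist_def walk_weight_def setcompr_eq_image)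

lemma weighted_dist_le:
  assumes "walk V E p"
  shows "weighted_dist V E \<omega> (hd p) (last p) \<le> walk_weight \<omega> p"
  unfolding weighted_dist_eq
  by (intro cINF_lower bdd_belowI2[of _ 0]) (use assms walk_weight_nonneg in auto)

text \<open>The differences of \<open>f\<close> telescope along the walk. The one-sided Lipschitz
  condition covers both signs, because \<open>{u, w}\<close> is unordered.\<close>

lemma potential_le_walk_weight:
  assumes "walk V E p" "\<And>u w. {u, w} \<in> E \<Longrightarrow> f u - f w \<le> \<omega> {u, w}"
  shows "f (hd p) - f (last p) \<le> walk_weight \<omega> p"
  using assms(1)
proof (induction p rule: induct_list012)
  case (3 x y p)
  then show ?case
    using assms(2)[of x y] by (auto simp: walk_def)
qed (auto simp: walk_def)

lemma potential_le_weighted_dist: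
  assumes "\<And>u w. {u, w} \<in> E \<Longrightarrow> f u - f w \<le> \<omega> {u, w}" "u \<in> V" "v \<in> V"
  shows "f u - f v \<le> weighted_dist V E \<omega> u v"
  unfolding weighted_dist_eq
proof (rule cINF_greatest)
  show "{p. walk V E p \<and> hd p = u \<and> last p = v} \<noteq> {}"
    using tree assms(2,3) unfolding finite_tree_def connected_graph_def by blast
qed (use potential_le_walk_weight assms in blast)

lemma weighted_dist_nonneg: "u \<in> V \<Longrightarrow> v \<in> V \<Longrightarrow> 0 \<le> weighted_dist V E \<omega> u v"
  using potential_le_weighted_dist[of "\<lambda>_. 0"] weight_pos by (auto simp: less_imp_le)

lemma weighted_dist_self: "u \<in> V \<Longrightarrow> weighted_dist V E \<omega> u u = 0"
  using weighted_dist_le[of "[u]"] weighted_dist_nonneg[of u u] by (auto simp: walk_def)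

text \<open>The component of \<open>a\<close> after the edge \<open>{a, b}\<close> has been deleted.\<close>

definition side :: "'a \<Rightarrow> 'a \<Rightarrow> 'a \<Rightarrow> bool" where
  "side a b = (\<lambda>u w. {u, w} \<in> E \<and> {u, w} \<noteq> {a, b})\<^sup>*\<^sup>* a"

lemma side_self: "side a b a"
  by (simp add: side_def)

lemma side_cong_edge:
  assumes "{u, w} \<in> E" "{u, w} \<noteq> {a, b}"
  shows "side a b u \<longleftrightarrow> side a b w"
  unfolding side_def
proof
  let ?R = "\<lambda>u w. {u, w} \<in> E \<and> {u, w} \<noteq> {a, b}"
  have "?R u w" "?R w u" using assms by (simp_all add: insert_commute)
  then show "?R\<^sup>*\<^sup>* a u \<Longrightarrow> ?R\<^sup>*\<^sup>* a w" "?R\<^sup>*\<^sup>* a w \<Longrightarrow> ?R\<^sup>*\<^sup>* a u"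
    using rtranclp.rtrancl_into_rtrancl[of ?R] by blast+
qed

text \<open>Acyclicity enters here: a simple path from \<open>a\<close> to \<open>b\<close> that
  avoids the edge \<open>{a, b}\<close> would close up with it to a cycle.\<close>

lemma not_side:
  assumes "{a, b} \<in> E"
  shows "\<not> side a b b"
proof
  assume "side a b b"
  then obtain p where p: "p \<noteq> []" "distinct p" "hd p = a" "last p = b"
    and succ: "successively (\<lambda>u w. {u, w} \<in> E \<and> {u, w} \<noteq> {a, b}) p"
    unfolding side_def by (blast dest: rtranclp_imp_distinct_list)
  have ab: "a \<noteq> b" "a \<in> V" using assms edgeD by auto
  obtain q where q: "p = a # q" using p by (cases p) auto
  with ab p have "q \<noteq> []" by auto
  then obtain c r where r: "p = a # c # r" using q by (cases q) auto
  \<comment> \<open>Otherwise \<open>c\<close> would be \<open>b\<close>, and the path would consist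
    of the deleted edge. So the cycle has length at least 3.\<close>
  have "r \<noteq> []" using r p succ by auto
  then have "3 \<le> length p" using r by (cases r) auto
  moreover have E: "successively (\<lambda>u w. {u, w} \<in> E) p"
    using succ by (rule successively_mono) auto
  have "set p \<subseteq> V"
  proof -
    have "set (x # p) \<subseteq> V" if "x \<in> V" "successively (\<lambda>u w. {u, w} \<in> E) (x # p)" for x p
      using that by (induction p arbitrary: x) (auto dest: edgeD)
    then show ?thesis using E q ab by blast
  qed
  then have "walk V E p" using E p by (simp add: walk_def)
  ultimately have "graph_cycle V E p"
    using p assms by (simp add: graph_cycle_def insert_commute)
  then show False using tree by (auto simp: finite_tree_def)
qed

context
  fixes x y :: 'a
  assumes xy: "{x, y} \<in> E"
begin

text \<open>The optimal Kantorovich potential: it drops by \<open>\<omega> e\<close> across every edge \<open>e\<close> that meets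
  \<open>{x, y}\<close>, in the direction from the branches at \<open>x\<close> to the branches at \<open>y\<close>, and is constant on
  each branch.\<close>

definition potential :: "'a \<Rightarrow> real" where
  "potential u = \<omega> {x, y} * of_bool (side x y u)
     + (\<Sum>z\<in>nbrs x - {y}. \<omega> {x, z} * of_bool (side z x u))
     - (\<Sum>z\<in>nbrs y - {x}. \<omega> {y, z} * of_bool (side z y u))"

text \<open>Crossing an edge changes the indicator of a branch only if it is the edge that attaches
  this branch to \<open>s\<close>. The lemma is kept generic in \<open>s\<close> and
  \<open>t\<close> to serve both sums of \<open>potential\<close>.\<close>

lemma branch_sum_diff:
  assumes "{u, w} \<in> E"
  shows "(\<Sum>z\<in>nbrs s - {t}. \<omega> {s, z} * of_bool (side z s u))
      - (\<Sum>z\<in>nbrs s - {t}. \<omega> {s, z} * of_bool (side z s w))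
    = (\<Sum>z\<in>nbrs s - {t}. if {u, w} = {s, z} then
          \<omega> {s, z} * (of_bool (side z s u) - of_bool (side z s w)) else 0)"
  unfolding sum_subtractf[symmetric]
proof (intro sum.cong refl)
  fix z
  show "\<omega> {s, z} * of_bool (side z s u) - \<omega> {s, z} * of_bool (side z s w) =
    (if {u, w} = {s, z} then \<omega> {s, z} * (of_bool (side z s u) - of_bool (side z s w)) else 0)"
    using side_cong_edge[OF assms, of z s] by (auto simp: insert_commute right_diff_distrib)
qed

lemma potential_diff_other:
  assumes "{u, w} \<in> E" "x \<notin> {u, w}" "y \<notin> {u, w}"
  shows "potential u - potential w = 0"
proof -
  have "side x y u \<longleftrightarrow> side x y w"
    using assms by (intro side_cong_edge) auto
  moreover have "{u, w} \<noteq> {x, z}" "{u, w} \<noteq> {y, z}" for z using assms by auto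
  ultimately show ?thesis
    using branch_sum_diff[OF assms(1), of x y] branch_sum_diff[OF assms(1), of y x]
    by (simp add: potential_def)
qed

lemma potential_diff_xy: "potential x - potential y = \<omega> {x, y}"
proof -
  have "{x, y} \<noteq> {x, z}" if "z \<in> nbrs x - {y}" for z using that by (auto simp: doubleton_eq_iff)
  moreover have "{x, y} \<noteq> {y, z}" if "z \<in> nbrs y - {x}" for z using that by (auto simp: doubleton_eq_iff)
  ultimately show ?thesis
    using branch_sum_diff[OF xy, of x y] branch_sum_diff[OF xy, of y x] side_self[of x y] not_side[OF xy]
    by (simp add: potential_def)
qed

text \<open>Moving from \<open>z\<close> to \<open>x\<close> stays on one side of
  \<open>{x, y}\<close> and leaves exactly one branch, that of \<open>z\<close>, so a single term of
  \<open>potential\<close> changes.\<close>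

lemma potential_diff_x:
  assumes z: "z \<in> nbrs x - {y}"
  shows "potential z - potential x = \<omega> {x, z}"
proof -
  have zx: "{z, x} \<in> E" and ne: "z \<noteq> y" "x \<noteq> y" "x \<noteq> z"
    using z xy by (auto simp: mem_nbrs insert_commute dest: edgeD)
  have "side x y z \<longleftrightarrow> side x y x"
    using zx ne by (intro side_cong_edge) (auto simp: doubleton_eq_iff)
  moreover have "{z, x} = {x, z'} \<longleftrightarrow> z' = z" for z' by (auto simp: doubleton_eq_iff)
  moreover have "{z, x} \<noteq> {y, z'}" for z' using ne by (auto simp: doubleton_eq_iff)
  ultimately show ?thesis
    using branch_sum_diff[OF zx, of x y] branch_sum_diff[OF zx, of y x] side_self[of z x]
      not_side[OF zx] z by (simp add: potential_def)
qed

lemma potential_diff_y: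
  assumes z: "z \<in> nbrs y - {x}"
  shows "potential z - potential y = - \<omega> {y, z}"
proof -
  have zy: "{z, y} \<in> E" and ne: "z \<noteq> x" "x \<noteq> y" "y \<noteq> z"
    using z xy by (auto simp: mem_nbrs insert_commute dest: edgeD)
  have "side x y z \<longleftrightarrow> side x y y"
    using zy ne by (intro side_cong_edge) (auto simp: doubleton_eq_iff)
  moreover have "{z, y} = {y, z'} \<longleftrightarrow> z' = z" for z' by (auto simp: doubleton_eq_iff)
  moreover have "{z, y} \<noteq> {x, z'}" for z' using ne by (auto simp: doubleton_eq_iff)
  ultimately show ?thesis
    using branch_sum_diff[OF zy, of x y] branch_sum_diff[OF zy, of y x] side_self[of z y]
      not_side[OF zy] z by (simp add: potential_def)
qed

text \<open>On edges meeting \<open>{x, y}\<close> the bound is attained up to sign, by the three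
  jump formulas; across all other edges the potential is constant.\<close>

lemma potential_lipschitz:
  assumes uw: "{u, w} \<in> E"
  shows "potential u - potential w \<le> \<omega> {u, w}"
proof -
  have half: "\<bar>potential u - potential w\<bar> \<le> \<omega> {u, w}" if "{u, w} \<in> E" "w = x \<or> w = y" for u w
  proof -
    have "u \<in> nbrs w" using that by (auto simp: mem_nbrs insert_commute)
    then have "u \<in> nbrs x - {y} \<and> w = x \<or> u \<in> nbrs y - {x} \<and> w = y \<or> u = x \<and> w = y \<or> u = y \<and> w = x"
      using that edgeD by auto
    moreover have "\<omega> {u, w} > 0" using weight_pos that by blast
    ultimately show ?thesis
      using potential_diff_x[of u] potential_diff_y[of u] potential_diff_xy
      by (auto simp: insert_commute)
  qed
  have "\<omega> {u, w} > 0" using weight_pos uw by blast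
  then show ?thesis
    using half[of u w] half[of w u] potential_diff_other[OF uw] uw
    by (cases "w = x \<or> w = y"; cases "u = x \<or> u = y") (auto simp: insert_commute)
qed

lemma weighted_dist_edge: "weighted_dist V E \<omega> x y = \<omega> {x, y}"
proof (rule antisym)
  show "weighted_dist V E \<omega> x y \<le> \<omega> {x, y}"
    using weighted_dist_le[of "[x, y]"] xy edgeD by (auto simp: walk_def)
  show "\<omega> {x, y} \<le> weighted_dist V E \<omega> x y"
    using potential_le_weighted_dist[of potential x y] potential_lipschitz potential_diff_xy xy edgeD
    by auto
qed

end

end

section \<open>Wasserstein distance between neighbouring walk measures and the curvature
  formula\<close>

locale unit_measure_tree = weighted_tree +
  fixes m1 :: "'a \<Rightarrow> real" and m2 :: "'a set \<Rightarrow> real"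
  assumes m1: "\<And>x. x \<in> V \<Longrightarrow> m1 x = 1" and m2: "\<And>e. e \<in> E \<Longrightarrow> m2 e = 1"
begin

abbreviation "\<mu> \<equiv> walk_measure V E m1 m2"

lemma walk_measure_unit:
  assumes "x \<in> V"
  shows "\<mu> \<epsilon> x u = (if u = x then 1 - \<epsilon> * card (nbrs x) else if u \<in> nbrs x then \<epsilon> else 0)"
  using assms m1 m2 by (auto simp: walk_measure_def weighted_deg_def mem_nbrs nbrs_def dest: edgeD)

text \<open>The walk measure is a heat step of size \<open>\<epsilon>\<close>: the sum over
  \<open>nbrs x\<close> is the graph Laplacian of \<open>f\<close> at \<open>x\<close>. Constant
  \<open>f\<close> gives total mass 1.\<close>

lemma sum_walk_measure:
  assumes "x \<in> V"
  shows "(\<Sum>u\<in>V. f u * \<mu> \<epsilon> x u) = f x + \<epsilon> * (\<Sum>z\<in>nbrs x. f z - f x)"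
proof -
  have x: "x \<notin> nbrs x" using edgeD[of x x] by (auto simp: mem_nbrs)
  have sub: "nbrs x \<subseteq> V" by (auto simp: nbrs_def)
  have "(\<Sum>u\<in>V. f u * \<mu> \<epsilon> x u)
     = (\<Sum>u\<in>V. (if u = x then f u * (1 - \<epsilon> * card (nbrs x)) else 0) + (if u \<in> nbrs x then f u * \<epsilon> else 0))"
    using x by (intro sum.cong) (auto simp: walk_measure_unit[OF assms])
  also have "\<dots> = f x * (1 - \<epsilon> * card (nbrs x)) + (\<Sum>u\<in>nbrs x. f u * \<epsilon>)"
    using assms finite_V sub by (simp add: sum.distrib sum.inter_restrict[symmetric] Int_absorb1)
  also have "\<dots> = f x + \<epsilon> * (\<Sum>z\<in>nbrs x. f z - f x)"
    by (simp add: sum_subtractf algebra_simps sum_distrib_left)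
  finally show ?thesis .
qed

context
  fixes x y :: 'a
  assumes xy: "{x, y} \<in> E"
begin

text \<open>The total weight of the neighbours of \<open>{x, y}\<close> in the line graph, sorted by
  the endpoint shared with \<open>{x, y}\<close>.\<close>

definition spread :: real where
  "spread = (\<Sum>z\<in>nbrs x - {y}. \<omega> {x, z}) + (\<Sum>z\<in>nbrs y - {x}. \<omega> {y, z})"

text \<open>Weak Kantorovich duality, tested with \<open>potential x y\<close>. Each of the two
  measures puts mass \<open>\<epsilon>\<close> on the other endpoint, which lowers the coefficient
  of \<open>\<omega> {x, y}\<close> from 1 to \<open>1 - 2 * \<epsilon>\<close>.\<close>

lemma coupling_cost_ge:
  assumes A: "coupling V (\<mu> \<epsilon> x) (\<mu> \<epsilon> y) A"
  shows "(1 - 2 * \<epsilon>) * \<omega> {x, y} + \<epsilon> * spread \<le> (\<Sum>u\<in>V. \<Sum>v\<in>V. weighted_dist V E \<omega> u v * A u v)"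
proof -
  let ?f = "potential x y"
  have V: "x \<in> V" "y \<in> V" using xy edgeD by auto
  have nb: "y \<in> nbrs x" "x \<in> nbrs y" using xy by (auto simp: mem_nbrs insert_commute)
  have S1: "(\<Sum>z\<in>nbrs x. ?f z - ?f x) = - \<omega> {x, y} + (\<Sum>z\<in>nbrs x - {y}. \<omega> {x, z})"
    using potential_diff_xy[OF xy] nb potential_diff_x[OF xy]
    by (subst sum.remove[of _ y]) (auto intro!: sum.cong)
  have S2: "(\<Sum>z\<in>nbrs y. ?f z - ?f y) = \<omega> {x, y} + (\<Sum>z\<in>nbrs y - {x}. - \<omega> {y, z})"
    using potential_diff_xy[OF xy] nb potential_diff_y[OF xy]
    by (subst sum.remove[of _ x]) (auto intro!: sum.cong)
  have "(1 - 2 * \<epsilon>) * \<omega> {x, y} + \<epsilon> * spread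
      = (\<Sum>u\<in>V. ?f u * \<mu> \<epsilon> x u) - (\<Sum>v\<in>V. ?f v * \<mu> \<epsilon> y v)"
    using potential_diff_xy[OF xy]
    unfolding sum_walk_measure[OF V(1)] sum_walk_measure[OF V(2)] S1 S2 spread_def sum_negf
    by (simp add: algebra_simps)
  also have "(\<Sum>u\<in>V. ?f u * \<mu> \<epsilon> x u) = (\<Sum>u\<in>V. \<Sum>v\<in>V. ?f u * A u v)"
    using A by (intro sum.cong refl) (simp add: coupling_def flip: sum_distrib_left)
  also have "(\<Sum>v\<in>V. ?f v * \<mu> \<epsilon> y v) = (\<Sum>v\<in>V. \<Sum>u\<in>V. ?f v * A u v)"
    using A by (intro sum.cong refl) (simp add: coupling_def flip: sum_distrib_left)
  also have "(\<Sum>v\<in>V. \<Sum>u\<in>V. ?f v * A u v) = (\<Sum>u\<in>V. \<Sum>v\<in>V. ?f v * A u v)"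
    by (rule sum.swap)
  also have "(\<Sum>u\<in>V. \<Sum>v\<in>V. ?f u * A u v) - \<dots> = (\<Sum>u\<in>V. \<Sum>v\<in>V. (?f u - ?f v) * A u v)"
    by (simp add: sum_subtractf left_diff_distrib)
  also have "\<dots> \<le> (\<Sum>u\<in>V. \<Sum>v\<in>V. weighted_dist V E \<omega> u v * A u v)"
    using A by (intro sum_mono mult_right_mono potential_le_weighted_dist potential_lipschitz xy)
      (auto simp: coupling_def)
  finally show ?thesis .
qed

text \<open>Mass \<open>\<epsilon>\<close> stays at \<open>x\<close> and at \<open>y\<close>; what remains of both measures is coupled independently,
  which is optimal because all of it has to cross the edge \<open>{x, y}\<close>.\<close>

lemma optimal_coupling:
  fixes \<epsilon> :: real
  assumes \<epsilon>: "0 < \<epsilon>" "\<epsilon> * (real (card V) + 2) < 1"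
  obtains A where "coupling V (\<mu> \<epsilon> x) (\<mu> \<epsilon> y) A"
    "(\<Sum>u\<in>V. \<Sum>v\<in>V. weighted_dist V E \<omega> u v * A u v) \<le> (1 - 2 * \<epsilon>) * \<omega> {x, y} + \<epsilon> * spread"
proof -
  have V: "x \<in> V" "y \<in> V" and neq: "x \<noteq> y" using xy edgeD by auto
  have nb: "y \<in> nbrs x" "x \<in> nbrs y" using xy by (auto simp: mem_nbrs insert_commute)
  \<comment> \<open>The mass common to both measures at \<open>x\<close> and \<open>y\<close>: each
    endpoint gets exactly \<open>\<epsilon>\<close> from the measure centred at the other
    one.\<close>
  define stay where "stay u = (if u = x then \<epsilon> else 0) + (if u = y then \<epsilon> else 0)" for u
  define \<alpha> where "\<alpha> u = \<mu> \<epsilon> x u - stay u" for u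
  define \<beta> where "\<beta> v = \<mu> \<epsilon> y v - stay v" for v
  define r where "r = 1 - 2 * \<epsilon>"
  define A where "A u v = (if u = v then stay u else 0) + \<alpha> u * \<beta> v / r" for u v
  \<comment> \<open>The cost of moving between \<open>u\<close> and \<open>s\<close> along the
    branch edge, which is 0 for \<open>u = s\<close>.\<close>
  define g where "g s t u = (if u \<in> nbrs s - {t} then \<omega> {s, u} else 0)" for s t u
  \<comment> \<open>The bound on \<open>\<epsilon>\<close> is used twice: it makes the moving mass
    \<open>r\<close> positive, and it leaves at least \<open>\<epsilon>\<close> at the centre of
    each measure, so that \<open>\<alpha>\<close> and \<open>\<beta>\<close> are
    nonnegative.\<close>
  have "\<epsilon> * 2 \<le> \<epsilon> * (real (card V) + 2)" using \<epsilon> by (intro mult_left_mono) auto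
  then have r: "r > 0" using \<epsilon> unfolding r_def by linarith
  have small: "\<epsilon> * card (nbrs z) + \<epsilon> \<le> 1" for z
  proof -
    have "card (nbrs z) \<le> card V" using finite_V by (intro card_mono) (auto simp: nbrs_def)
    then have "\<epsilon> * (real (card (nbrs z)) + 1) \<le> \<epsilon> * (real (card V) + 2)"
      using \<epsilon> by (intro mult_left_mono) auto
    then show ?thesis using \<epsilon> by (simp add: distrib_left)
  qed
  have stay0: "stay u \<ge> 0" for u using \<epsilon> by (simp add: stay_def)
  \<comment> \<open>After removal of the common mass nothing of the first measure is left at
    \<open>y\<close>, and nothing of the second at \<open>x\<close>. So every unit of
    \<open>\<alpha>\<close> has to cross \<open>{x, y}\<close>.\<close>
  have \<alpha>: "\<alpha> u \<ge> 0" "\<alpha> u \<noteq> 0 \<Longrightarrow> u = x \<or> u \<in> nbrs x - {y}" for u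
    using neq \<epsilon> nb small[of x] by (auto simp: \<alpha>_def stay_def walk_measure_unit V split: if_splits)
  have \<beta>: "\<beta> u \<ge> 0" "\<beta> u \<noteq> 0 \<Longrightarrow> u = y \<or> u \<in> nbrs y - {x}" for u
    using neq \<epsilon> nb small[of y] by (auto simp: \<beta>_def stay_def walk_measure_unit V split: if_splits)
  have stay: "(\<Sum>u\<in>V. stay u) = 2 * \<epsilon>"
    using V finite_V by (simp add: stay_def sum.distrib)
  have sum1: "(\<Sum>u\<in>V. \<mu> \<epsilon> z u) = 1" if "z \<in> V" for z
    using sum_walk_measure[OF that, of "\<lambda>_. 1"] by simp
  have s\<alpha>: "(\<Sum>u\<in>V. \<alpha> u) = r" and s\<beta>: "(\<Sum>u\<in>V. \<beta> u) = r"
    using sum1 V stay by (simp_all add: \<alpha>_def \<beta>_def r_def sum_subtractf)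
  have cpl: "coupling V (\<mu> \<epsilon> x) (\<mu> \<epsilon> y) A"
    unfolding coupling_def
  proof (intro conjI ballI)
    fix u v assume uv: "u \<in> V" "v \<in> V"
    show "0 \<le> A u v" using stay0 \<alpha>(1) \<beta>(1) r by (simp add: A_def)
  next
    fix u assume u: "u \<in> V"
    have "(\<Sum>v\<in>V. A u v) = stay u + \<alpha> u * (\<Sum>v\<in>V. \<beta> v) / r"
      using u finite_V by (simp add: A_def sum.distrib sum_distrib_left sum_divide_distrib)
    then show "(\<Sum>v\<in>V. A u v) = \<mu> \<epsilon> x u" using r by (simp add: s\<beta> \<alpha>_def)
  next
    fix v assume v: "v \<in> V"
    have "(\<Sum>u\<in>V. A u v) = stay v + (\<Sum>u\<in>V. \<alpha> u) * \<beta> v / r"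
      using v finite_V by (simp add: A_def sum.distrib sum_distrib_right sum_divide_distrib)
    then show "(\<Sum>u\<in>V. A u v) = \<mu> \<epsilon> y v" using r by (simp add: s\<alpha> \<beta>_def)
  qed
  have dist: "weighted_dist V E \<omega> u v \<le> g x y u + \<omega> {x, y} + g y x v"
    if u: "u = x \<or> u \<in> nbrs x - {y}" and v: "v = y \<or> v \<in> nbrs y - {x}" for u v
  proof -
    have ux: "{u, x} \<in> E" if "u \<noteq> x" using u that by (auto simp: mem_nbrs insert_commute)
    have yv: "{y, v} \<in> E" if "v \<noteq> y" using v that by (auto simp: mem_nbrs)
    have uv: "u \<in> V" "v \<in> V" using u v V by (auto simp: nbrs_def)
    have self: "x \<notin> nbrs x" "y \<notin> nbrs y" using edgeD[of x x] edgeD[of y y] by (auto simp: mem_nbrs)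
    show ?thesis
      using weighted_dist_le[of "[x, y]"] weighted_dist_le[of "[u, x, y]"]
        weighted_dist_le[of "[x, y, v]"] weighted_dist_le[of "[u, x, y, v]"] u v ux yv uv V xy self
      by (cases "u = x"; cases "v = y") (auto simp: walk_def g_def insert_commute)
  qed
  have sg: "(\<Sum>u\<in>V. g s t u * (\<mu> \<epsilon> s u - stay u)) = \<epsilon> * (\<Sum>z\<in>nbrs s - {t}. \<omega> {s, z})"
    if st: "s = x \<and> t = y \<or> s = y \<and> t = x" for s t
  proof -
    have s: "s \<in> V" "s \<notin> nbrs s" using st V edgeD[of s s] by (auto simp: mem_nbrs)
    have "(\<Sum>u\<in>V. g s t u * (\<mu> \<epsilon> s u - stay u)) = (\<Sum>u\<in>V. if u \<in> nbrs s - {t} then \<epsilon> * \<omega> {s, u} else 0)"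
      using st s by (intro sum.cong) (auto simp: g_def walk_measure_unit stay_def)
    also have "\<dots> = (\<Sum>z\<in>nbrs s - {t}. \<epsilon> * \<omega> {s, z})"
      using finite_V by (subst sum.inter_restrict[symmetric]) (auto simp: nbrs_def intro!: sum.cong)
    finally show ?thesis by (simp add: sum_distrib_left)
  qed
  have "(\<Sum>u\<in>V. \<Sum>v\<in>V. weighted_dist V E \<omega> u v * A u v)
      \<le> (\<Sum>u\<in>V. \<Sum>v\<in>V. (g x y u + \<omega> {x, y} + g y x v) * (\<alpha> u * \<beta> v / r))"
  proof (intro sum_mono)
    fix u v assume uv: "u \<in> V" "v \<in> V"
    \<comment> \<open>The diagonal part of \<open>A\<close> costs nothing.\<close>
    have "weighted_dist V E \<omega> u v * A u v = weighted_dist V E \<omega> u v * (\<alpha> u * \<beta> v / r)"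
      using weighted_dist_self uv by (simp add: A_def distrib_left)
    also have "\<dots> \<le> (g x y u + \<omega> {x, y} + g y x v) * (\<alpha> u * \<beta> v / r)"
    proof (cases "\<alpha> u = 0 \<or> \<beta> v = 0")
      case False
      then have "weighted_dist V E \<omega> u v \<le> g x y u + \<omega> {x, y} + g y x v"
        using \<alpha>(2) \<beta>(2) by (intro dist) auto
      then show ?thesis using \<alpha>(1) \<beta>(1) r by (intro mult_right_mono) auto
    qed auto
    finally show "weighted_dist V E \<omega> u v * A u v \<le> (g x y u + \<omega> {x, y} + g y x v) * (\<alpha> u * \<beta> v / r)" .
  qed
  \<comment> \<open>The cost bound is a sum of a function of \<open>u\<close>, a constant and a
    function of \<open>v\<close>, so against a product measure every double sum factorises.\<close>
  also have "\<dots> = (\<Sum>u\<in>V. \<Sum>v\<in>V. (g x y u * \<alpha> u) * (\<beta> v / r))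
      + \<omega> {x, y} * (\<Sum>u\<in>V. \<Sum>v\<in>V. \<alpha> u * (\<beta> v / r))
      + (\<Sum>u\<in>V. \<Sum>v\<in>V. (\<alpha> u / r) * (g y x v * \<beta> v))"
  proof -
    have "(g x y u + \<omega> {x, y} + g y x v) * (\<alpha> u * \<beta> v / r)
        = (g x y u * \<alpha> u) * (\<beta> v / r) + \<omega> {x, y} * (\<alpha> u * (\<beta> v / r)) + (\<alpha> u / r) * (g y x v * \<beta> v)"
      for u v using r by (simp add: field_simps)
    then show ?thesis by (simp only: sum.distrib sum_distrib_left)
  qed
  also have "\<dots> = (\<Sum>u\<in>V. g x y u * \<alpha> u) * ((\<Sum>v\<in>V. \<beta> v) / r)
      + \<omega> {x, y} * ((\<Sum>u\<in>V. \<alpha> u) * ((\<Sum>v\<in>V. \<beta> v) / r))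
      + ((\<Sum>u\<in>V. \<alpha> u) / r) * (\<Sum>v\<in>V. g y x v * \<beta> v)"
    by (simp only: sum_product sum_divide_distrib)
  also have "\<dots> = (1 - 2 * \<epsilon>) * \<omega> {x, y} + \<epsilon> * spread"
  proof -
    have "(\<Sum>u\<in>V. g x y u * \<alpha> u) = \<epsilon> * (\<Sum>z\<in>nbrs x - {y}. \<omega> {x, z})"
      "(\<Sum>v\<in>V. g y x v * \<beta> v) = \<epsilon> * (\<Sum>z\<in>nbrs y - {x}. \<omega> {y, z})"
      unfolding \<alpha>_def \<beta>_def by (simp_all add: sg)
    then show ?thesis using r by (simp add: s\<alpha> s\<beta> r_def spread_def distrib_left mult.commute)
  qed
  finally have "(\<Sum>u\<in>V. \<Sum>v\<in>V. weighted_dist V E \<omega> u v * A u v) \<le> (1 - 2 * \<epsilon>) * \<omega> {x, y} + \<epsilon> * spread" .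
  with cpl show thesis by (rule that)
qed

lemma wasserstein_edge:
  fixes \<epsilon> :: real
  assumes \<epsilon>: "0 < \<epsilon>" "\<epsilon> * (real (card V) + 2) < 1"
  shows "wasserstein V E \<omega> (\<mu> \<epsilon> x) (\<mu> \<epsilon> y) = (1 - 2 * \<epsilon>) * \<omega> {x, y} + \<epsilon> * spread" (is "_ = ?R")
proof -
  obtain A where A: "coupling V (\<mu> \<epsilon> x) (\<mu> \<epsilon> y) A"
    "(\<Sum>u\<in>V. \<Sum>v\<in>V. weighted_dist V E \<omega> u v * A u v) \<le> ?R"
    using optimal_coupling[OF \<epsilon>] by blast
  have "(\<Sum>u\<in>V. \<Sum>v\<in>V. weighted_dist V E \<omega> u v * A u v) = ?R"
    using A coupling_cost_ge by (intro antisym) auto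
  then show ?thesis
    unfolding wasserstein_def using A coupling_cost_ge by (intro cInf_eq_minimum) force+
qed

text \<open>For \<open>\<epsilon>\<close> below the threshold \<open>1 / (card V + 2)\<close> the
  difference quotient no longer depends on \<open>\<epsilon>\<close>, so the limit is that of an
  eventually constant function.\<close>

lemma curvature_edge: "lly_curvature V E m1 m2 \<omega> x y = 2 - spread / \<omega> {x, y}"
proof -
  have w: "\<omega> {x, y} > 0" using weight_pos xy by blast
  have "\<forall>\<^sub>F \<epsilon> in at_right (0::real). 0 < \<epsilon> \<and> \<epsilon> < 1 / (real (card V) + 2)"
    by (auto simp: eventually_at_right_field intro!: exI[of _ "1 / (real (card V) + 2)"])
  then have "\<forall>\<^sub>F \<epsilon> in at_right 0. 1 / \<epsilon> *
       (1 - wasserstein V E \<omega> (\<mu> \<epsilon> x) (\<mu> \<epsilon> y) / weighted_dist V E \<omega> x y) = 2 - spread / \<omega> {x, y}"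
  proof eventually_elim
    case (elim \<epsilon>)
    then have "\<epsilon> * (real (card V) + 2) < 1" by (simp add: field_simps)
    then have W: "wasserstein V E \<omega> (\<mu> \<epsilon> x) (\<mu> \<epsilon> y) = (1 - 2 * \<epsilon>) * \<omega> {x, y} + \<epsilon> * spread"
      using elim by (intro wasserstein_edge) auto
    show ?case using elim w unfolding W weighted_dist_edge[OF xy] by (simp add: field_simps)
  qed
  then show ?thesis
    unfolding lly_curvature_def by (intro tendsto_Lim tendsto_eventually) auto
qed

text \<open>This turns the curvature formula into one with the adjacency matrix of the line graph,
  which makes the flow a linear system.\<close>

lemma spread_eq_line_graph_sum:
  "spread = (\<Sum>e\<in>E. of_bool (adjacent_edges {x, y} e) * \<omega> e)"
proof -
  let ?B = "\<lambda>s t. (\<lambda>z. {s, z}) ` (nbrs s - {t})"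
  have V: "x \<noteq> y" "x \<in> V" "y \<in> V" using xy edgeD by auto
  have finE: "finite E" using tree finite_tree_edges by blast
  have "{e \<in> E. adjacent_edges {x, y} e} = ?B x y \<union> ?B y x"
  proof (intro equalityI subsetI)
    fix e assume e: "e \<in> {e \<in> E. adjacent_edges {x, y} e}"
    then obtain z where "e = {x, z} \<or> e = {y, z}"
      using tree by (fastforce simp: adjacent_edges_def finite_tree_def simple_graph_def)
    then show "e \<in> ?B x y \<union> ?B y x"
      using e by (auto simp: adjacent_edges_def mem_nbrs doubleton_eq_iff)
  qed (use V in \<open>auto simp: adjacent_edges_def mem_nbrs doubleton_eq_iff\<close>)
  moreover have "?B x y \<inter> ?B y x = {}" using V by (auto simp: doubleton_eq_iff)
  moreover have "(\<Sum>e\<in>?B s t. \<omega> e) = (\<Sum>z\<in>nbrs s - {t}. \<omega> {s, z})" for s t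
    by (subst sum.reindex) (auto simp: inj_on_def doubleton_eq_iff)
  ultimately have "(\<Sum>e\<in>{e \<in> E. adjacent_edges {x, y} e}. \<omega> e) = spread"
    by (simp add: sum.union_disjoint spread_def)
  moreover have "(\<Sum>e\<in>{e \<in> E. adjacent_edges {x, y} e}. \<omega> e)
      = (\<Sum>e\<in>E. of_bool (adjacent_edges {x, y} e) * \<omega> e)"
    using finE by (intro sum.mono_neutral_cong_left) auto
  ultimately show ?thesis by simp
qed

end

end

subsection \<open>The spectral radius of the line graph\<close>

text \<open>Summing the eigenvalue equation over all edges weights each \<open>v e\<close> with the
  degree of \<open>e\<close> in the line graph. On a path these degrees are at most 2, and at most 1
  at the end edge \<open>c 0\<close>, whence the strict inequality.\<close>

lemma path_spectral_radius_less:
  fixes v :: "'a set \<Rightarrow> real"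
  assumes path: "is_path V E" and E: "finite E" "E \<noteq> {}" and pos: "\<And>e. e \<in> E \<Longrightarrow> v e > 0"
    and eigen: "\<And>e. e \<in> E \<Longrightarrow> (\<Sum>e'\<in>E. of_bool (adjacent_edges e e') * v e') = \<rho> * v e"
  shows "\<rho> < 2"
proof -
  obtain p where p: "distinct p" and Ep: "E = {{p ! i, p ! Suc i} | i. Suc i < length p}"
    using path unfolding is_path_def by blast
  define c where "c i = {p ! i, p ! Suc i}" for i
  define N where "N e = {e' \<in> E. adjacent_edges e e'}" for e
  have len: "Suc 0 < length p" using E Ep by auto
  have eq: "p ! i = p ! j \<longleftrightarrow> i = j" if "i < length p" "j < length p" for i j
    using p that by (rule nth_eq_iff_index_eq)
  \<comment> \<open>The case \<open>i = 0\<close> is separate because \<open>i - 1\<close> would be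
    0 again. For the last edge \<open>c (Suc i)\<close> is not meaningful, which is harmless in an
    upper bound.\<close>
  have N: "N (c i) \<subseteq> insert (c (Suc i)) (if i = 0 then {} else {c (i - 1)})" if "Suc i < length p" for i
  proof
    fix e assume "e \<in> N (c i)"
    then obtain j where j: "Suc j < length p" "e = c j" "adjacent_edges (c i) (c j)"
      unfolding N_def Ep c_def by blast
    have "j = Suc i \<or> i = Suc j"
      using j that by (auto simp: adjacent_edges_def c_def eq)
    then show "e \<in> insert (c (Suc i)) (if i = 0 then {} else {c (i - 1)})" using j by auto
  qed
  have c0: "c 0 \<in> E" using len by (auto simp: Ep c_def)
  have card: "card (N (c i)) \<le> (if i = 0 then 1 else 2)" if "Suc i < length p" for i
    using card_mono[OF _ N[OF that]] card_insert_le_m1[of 2 "{c (i - 1)}" "c (Suc i)"]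
    by (auto split: if_splits)
  have deg: "card (N e) \<le> 2" if e: "e \<in> E" for e
  proof -
    obtain i where "e = c i" "Suc i < length p" using e unfolding Ep c_def by blast
    then show ?thesis using card[of i] by (auto split: if_splits)
  qed
  have degree_sum: "(\<Sum>e\<in>E. of_bool (adjacent_edges e e')) = real (card (N e'))" for e' :: "'a set"
  proof -
    have "{e \<in> E. adjacent_edges e e'} = N e'" unfolding N_def using adjacent_edges_sym by blast
    then show ?thesis using E(1) by (simp add: of_bool_def Int_def flip: sum.inter_filter)
  qed
  have "\<rho> * (\<Sum>e\<in>E. v e) = (\<Sum>e\<in>E. \<Sum>e'\<in>E. of_bool (adjacent_edges e e') * v e')"
    by (simp add: eigen sum_distrib_left)
  also have "\<dots> = (\<Sum>e'\<in>E. \<Sum>e\<in>E. of_bool (adjacent_edges e e') * v e')"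
    by (rule sum.swap)
  also have "\<dots> = (\<Sum>e'\<in>E. real (card (N e')) * v e')"
    by (simp only: degree_sum flip: sum_distrib_right)
  also have "\<dots> < (\<Sum>e'\<in>E. 2 * v e')"
  proof (rule sum_strict_mono_ex1)
    show "\<forall>e\<in>E. real (card (N e)) * v e \<le> 2 * v e"
    proof
      fix e assume "e \<in> E"
      then show "real (card (N e)) * v e \<le> 2 * v e"
        using deg[of e] pos[of e] by (intro mult_right_mono) auto
    qed
    have "real (card (N (c 0))) * v (c 0) < 2 * v (c 0)"
      using card[of 0] len pos[OF c0] by (intro mult_strict_right_mono) auto
    then show "\<exists>e\<in>E. real (card (N e)) * v e < 2 * v e" using c0 by blast
  qed (use E in auto)
  also have "\<dots> = 2 * (\<Sum>e\<in>E. v e)" by (simp add: sum_distrib_left)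
  finally have "\<rho> * (\<Sum>e\<in>E. v e) < 2 * (\<Sum>e\<in>E. v e)" .
  moreover have "(\<Sum>e\<in>E. v e) > 0" using E pos by (intro sum_pos) auto
  ultimately show ?thesis by simp
qed

text \<open>The line graph is a triangle, so adding the three eigenvalue equations counts every
  \<open>v e\<close> twice.\<close>

lemma K13_spectral_radius:
  fixes v :: "'a set \<Rightarrow> real"
  assumes K13: "is_K13 V E" and pos: "\<And>e. e \<in> E \<Longrightarrow> v e > 0"
    and eigen: "\<And>e. e \<in> E \<Longrightarrow> (\<Sum>e'\<in>E. of_bool (adjacent_edges e e') * v e') = \<rho> * v e"
  shows "\<rho> = 2"
proof -
  obtain c x y z where d: "distinct [c, x, y, z]" and E: "E = {{c, x}, {c, y}, {c, z}}"
    using K13 unfolding is_K13_def by blast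
  have ne: "{c, x} \<noteq> {c, y}" "{c, x} \<noteq> {c, z}" "{c, y} \<noteq> {c, z}"
    using d by (auto simp: doubleton_eq_iff)
  have "v {c, y} + v {c, z} = \<rho> * v {c, x}" "v {c, x} + v {c, z} = \<rho> * v {c, y}"
    "v {c, x} + v {c, y} = \<rho> * v {c, z}"
    using eigen[of "{c, x}"] eigen[of "{c, y}"] eigen[of "{c, z}"] ne ne[symmetric]
    unfolding E by (simp_all add: adjacent_edges_def)
  then have "\<rho> * (v {c, x} + v {c, y} + v {c, z}) = 2 * (v {c, x} + v {c, y} + v {c, z})"
    unfolding distrib_left by linarith
  moreover have "v {c, x} > 0" "v {c, y} > 0" "v {c, z} > 0" using pos by (auto simp: E)
  ultimately show ?thesis by (subst (asm) mult_cancel_right) auto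
qed

text \<open>Three edges at a branching vertex form a triangle in the line graph, and a further edge
  \<open>e4\<close> is attached to it. Summing the eigenvalue equations over the triangle gives
  twice its weight plus at least \<open>v e4\<close>, which is positive.\<close>

lemma branching_spectral_radius_greater:
  fixes v :: "'a set \<Rightarrow> real"
  assumes tree: "finite_tree V E" and deg: "Max (vertex_degree V E ` V) \<ge> 3" and K13: "\<not> is_K13 V E"
    and pos: "\<And>e. e \<in> E \<Longrightarrow> v e > 0"
    and eigen: "\<And>e. e \<in> E \<Longrightarrow> (\<Sum>e'\<in>E. of_bool (adjacent_edges e e') * v e') = \<rho> * v e"
  shows "\<rho> > 2"
proof -
  have V: "finite V" "V \<noteq> {}"
    using tree by (auto simp: finite_tree_def simple_graph_def connected_graph_def)
  have finE: "finite E" using tree by (rule finite_tree_edges)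
  have "Max (vertex_degree V E ` V) \<in> vertex_degree V E ` V" using V by simp
  then obtain x where x: "x \<in> V" "3 \<le> card {y \<in> V. {x, y} \<in> E}"
    using deg by (auto simp: vertex_degree_def)
  then obtain Y where "Y \<subseteq> {y \<in> V. {x, y} \<in> E}" "card Y = 3"
    by (meson obtain_subset_with_card_n)
  then obtain y1 y2 y3 where y: "{x, y1} \<in> E" "{x, y2} \<in> E" "{x, y3} \<in> E"
    and yV: "y1 \<in> V" "y2 \<in> V" "y3 \<in> V" and dist: "y1 \<noteq> y2" "y1 \<noteq> y3" "y2 \<noteq> y3"
    by (auto simp: card_3_iff)
  have xy: "x \<noteq> y1" "x \<noteq> y2" "x \<noteq> y3"
    using y tree by (fastforce simp: finite_tree_def simple_graph_def)+
  define S where "S = {{x, y1}, {x, y2}, {x, y3}}"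
  \<comment> \<open>A tree with edge set \<open>S\<close> has no further vertices, as these would be
    isolated; it would be the excluded star.\<close>
  have "S \<noteq> E"
  proof
    assume SE: "S = E"
    have "w \<in> {x, y1, y2, y3}" if w: "w \<in> V" for w
    proof (rule ccontr)
      assume n: "w \<notin> {x, y1, y2, y3}"
      then obtain z where "{w, z} \<in> E"
        using finite_tree_no_isolated_vertex[OF tree w x(1)] by blast
      then show False using n by (auto simp: SE[symmetric] S_def doubleton_eq_iff)
    qed
    then have "V = {x, y1, y2, y3}" using x yV by blast
    then have "is_K13 V E"
      unfolding is_K13_def SE[symmetric] S_def using dist xy
      by (intro exI[of _ x] exI[of _ y1] exI[of _ y2] exI[of _ y3]) simp
    then show False using K13 by simp
  qed
  moreover have SE: "S \<subseteq> E" using y by (auto simp: S_def)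
  moreover have "S \<noteq> {}" by (simp add: S_def)
  ultimately obtain e e4 where e: "e \<in> S" "e4 \<in> E" "adjacent_edges e e4" "e4 \<notin> S"
    using line_graph_connected[OF tree, of S] by blast
  have ne: "{x, y1} \<noteq> {x, y2}" "{x, y1} \<noteq> {x, y3}" "{x, y2} \<noteq> {x, y3}"
    using dist by (auto simp: doubleton_eq_iff)
  \<comment> \<open>Dropping all other edges only decreases the sum, since the entries of
    \<open>v\<close> are positive.\<close>
  have lower: "(\<Sum>e'\<in>insert e4 S. of_bool (adjacent_edges d e') * v e') \<le> \<rho> * v d" if "d \<in> E" for d
    unfolding eigen[OF that, symmetric]
    using finE e SE pos by (intro sum_mono2) (auto simp: less_imp_le)
  let ?s = "v {x, y1} + v {x, y2} + v {x, y3}"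
  have v4: "v e4 > 0" and vS: "v {x, y1} > 0" "v {x, y2} > 0" "v {x, y3} > 0"
    using pos e y by auto
  have "2 * ?s + v e4 \<le> \<rho> * ?s"
  proof -
    have "e4 \<noteq> {x, y1}" "e4 \<noteq> {x, y2}" "e4 \<noteq> {x, y3}" using e by (auto simp: S_def)
    moreover have "adjacent_edges {x, y1} e4 \<or> adjacent_edges {x, y2} e4 \<or> adjacent_edges {x, y3} e4"
      using e by (auto simp: S_def)
    moreover have "adjacent_edges {x, y1} {x, y2}" "adjacent_edges {x, y1} {x, y3}"
      "adjacent_edges {x, y2} {x, y3}" "adjacent_edges {x, y2} {x, y1}"
      "adjacent_edges {x, y3} {x, y1}" "adjacent_edges {x, y3} {x, y2}"
      "\<not> adjacent_edges d d" for d :: "'a set"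
      using ne by (auto simp: adjacent_edges_def)
    ultimately show ?thesis
      using lower[OF y(1)] lower[OF y(2)] lower[OF y(3)] ne v4
      by (auto simp: S_def distrib_left of_bool_def split: if_splits)
  qed
  then have "2 * ?s < \<rho> * ?s" using v4 by simp
  then show ?thesis using vS by (subst (asm) mult_less_cancel_right_pos) auto
qed

subsection \<open>The Ricci flow\<close>

lemma line_graph_irreducible:
  assumes "finite_tree V E" "E \<noteq> {}"
  shows "irreducible_symmetric E (\<lambda>e e'. of_bool (adjacent_edges e e'))"
proof
  fix S assume "S \<subseteq> E" "S \<noteq> {}"
    "\<And>e e'. e \<in> S \<Longrightarrow> e' \<in> E \<Longrightarrow> (0::real) < of_bool (adjacent_edges e e') \<Longrightarrow> e' \<in> S"
  then show "S = E" by (intro line_graph_connected[OF assms(1)]) auto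
qed (use assms finite_tree_edges adjacent_edges_sym in auto)

text \<open>All cases of the theorem follow from these limits once the sign of
  \<open>\<rho> - 2\<close> is known. Positivity of \<open>c\<close> forces every weight to follow
  the Perron mode.\<close>

lemma ricci_flow_asymptotics:
  fixes \<omega> :: "real \<Rightarrow> 'a set \<Rightarrow> real"
  assumes tree: "finite_tree V E" and ne: "E \<noteq> {}"
    and m1: "\<And>x. x \<in> V \<Longrightarrow> m1 x = 1" and m2: "\<And>e. e \<in> E \<Longrightarrow> m2 e = 1"
    and flow: "ricci_flow V E m1 m2 \<omega>0 \<omega>"
  obtains v \<rho> c where "\<And>e. e \<in> E \<Longrightarrow> v e > 0" "c > 0"
    "\<And>e. e \<in> E \<Longrightarrow> (\<Sum>e'\<in>E. of_bool (adjacent_edges e e') * v e') = \<rho> * v e"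
    "\<And>e. e \<in> E \<Longrightarrow> ((\<lambda>t. \<omega> t e * exp (- ((\<rho> - 2) * t))) \<longlongrightarrow> c * v e) at_top"
    "\<And>x y. {x, y} \<in> E \<Longrightarrow> ((\<lambda>t. lly_curvature V E m1 m2 (\<omega> t) x y) \<longlongrightarrow> 2 - \<rho>) at_top"
proof -
  define a where "a e e' = (of_bool (adjacent_edges e e') :: real)" for e e' :: "'a set"
  interpret irreducible_symmetric E a
    unfolding a_def using tree ne by (rule line_graph_irreducible)
  obtain v \<rho> where v: "\<And>e. e \<in> E \<Longrightarrow> v e > 0"
    and eigen: "\<And>e. e \<in> E \<Longrightarrow> (\<Sum>e'\<in>E. a e e' * v e') = \<rho> * v e"
    and unit: "(\<Sum>e\<in>E. (v e)\<^sup>2) = 1"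
    by (rule perron_vector) (rule that)
  have pos: "\<omega> t e > 0" if "t \<ge> 0" "e \<in> E" for t e
    using flow that by (simp add: ricci_flow_def)
  have curv: "lly_curvature V E m1 m2 (\<omega> t) x y = 2 - (\<Sum>e'\<in>E. a {x, y} e' * \<omega> t e') / \<omega> t {x, y}"
    if t: "t \<ge> 0" and xy: "{x, y} \<in> E" for t x y
  proof -
    interpret T: unit_measure_tree V E "\<omega> t" m1 m2
      by (intro unit_measure_tree.intro weighted_tree.intro unit_measure_tree_axioms.intro
          tree m1 m2 pos t)
    show ?thesis
      by (simp add: T.curvature_edge[OF xy] T.spread_eq_line_graph_sum[OF xy] a_def)
  qed
  have pair: "\<exists>x y. e = {x, y}" if "e \<in> E" for e
    using tree that unfolding finite_tree_def simple_graph_def by blast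
  have der: "((\<lambda>s. \<omega> s e) has_real_derivative (\<Sum>e'\<in>E. a e e' * \<omega> t e') - 2 * \<omega> t e) (at t)"
    if t: "t > 0" and e: "e \<in> E" for t e
  proof -
    obtain x y where xy: "e = {x, y}" using pair e by blast
    have "((\<lambda>s. \<omega> s e) has_real_derivative
        - lly_curvature V E m1 m2 (\<omega> t) x y * \<omega> t e) (at t)"
      using flow t e unfolding ricci_flow_def xy by blast
    also have "- lly_curvature V E m1 m2 (\<omega> t) x y * \<omega> t e = (\<Sum>e'\<in>E. a e e' * \<omega> t e') - 2 * \<omega> t e"
      using curv[of t x y] pos[of t e] t e by (simp add: xy field_simps)
    finally show ?thesis .
  qed
  \<comment> \<open>Removing the growth rate \<open>\<rho> - 2\<close> replaces the matrix shift 2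
    by \<open>\<rho>\<close>, so that \<open>v\<close> becomes stationary.\<close>
  define u where "u t e = \<omega> t e * exp (- ((\<rho> - 2) * t))" for t e
  have der_u: "((\<lambda>s. u s e) has_real_derivative (\<Sum>e'\<in>E. a e e' * u t e') - \<rho> * u t e) (at t)"
    if t: "t > 0" and e: "e \<in> E" for t e
  proof -
    have "((\<lambda>s. u s e) has_real_derivative
        ((\<Sum>e'\<in>E. a e e' * \<omega> t e') - 2 * \<omega> t e) * exp (- ((\<rho> - 2) * t))
        + exp (- ((\<rho> - 2) * t)) * (- (\<rho> - 2)) * \<omega> t e) (at t)"
      unfolding u_def by (intro DERIV_mult der t e) (auto intro!: derivative_eq_intros)
    also have "((\<Sum>e'\<in>E. a e e' * \<omega> t e') - 2 * \<omega> t e) * exp (- ((\<rho> - 2) * t))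
        + exp (- ((\<rho> - 2) * t)) * (- (\<rho> - 2)) * \<omega> t e
      = (\<Sum>e'\<in>E. a e e' * \<omega> t e') * exp (- ((\<rho> - 2) * t)) - \<rho> * u t e"
      by (simp add: u_def algebra_simps)
    also have "(\<Sum>e'\<in>E. a e e' * \<omega> t e') * exp (- ((\<rho> - 2) * t)) = (\<Sum>e'\<in>E. a e e' * u t e')"
      by (simp add: u_def sum_distrib_right mult.assoc)
    finally show ?thesis .
  qed
  define c where "c = (\<Sum>e\<in>E. v e * u 1 e)"
  \<comment> \<open>Both the Perron vector and the weights are positive, hence so is their inner
    product.\<close>
  have c: "c > 0"
    unfolding c_def u_def using fin ne v pos by (intro sum_pos) auto
  have lim: "((\<lambda>t. u t e) \<longlongrightarrow> c * v e) at_top" if "e \<in> E" for e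
    unfolding c_def using v eigen unit der_u that by (rule normalized_flow_converges)
  have "((\<lambda>t. lly_curvature V E m1 m2 (\<omega> t) x y) \<longlongrightarrow> 2 - \<rho>) at_top" if xy: "{x, y} \<in> E" for x y
  proof -
    \<comment> \<open>The curvature is invariant under scaling of the weights, so it can be computed
      from \<open>u\<close>, whose limit is positive and finite, whereas \<open>\<omega>\<close>
      itself may tend to 0 or to infinity.\<close>
    have "((\<lambda>t. 2 - (\<Sum>e'\<in>E. a {x, y} e' * u t e') / u t {x, y})
        \<longlongrightarrow> 2 - (\<Sum>e'\<in>E. a {x, y} e' * (c * v e')) / (c * v {x, y})) at_top"
      using c v[OF xy] by (intro tendsto_intros lim xy) auto
    also have "(\<Sum>e'\<in>E. a {x, y} e' * (c * v e')) = c * (\<Sum>e'\<in>E. a {x, y} e' * v e')"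
      by (simp add: sum_distrib_left mult_ac)
    also have "2 - c * (\<Sum>e'\<in>E. a {x, y} e' * v e') / (c * v {x, y}) = 2 - \<rho>"
      using c v[OF xy] eigen[OF xy] by simp
    finally show ?thesis
    proof (rule Lim_transform_eventually)
      show "\<forall>\<^sub>F t in at_top. 2 - (\<Sum>e'\<in>E. a {x, y} e' * u t e') / u t {x, y}
          = lly_curvature V E m1 m2 (\<omega> t) x y"
        using eventually_ge_at_top[of 0]
      proof eventually_elim
        case (elim t)
        have "(\<Sum>e'\<in>E. a {x, y} e' * u t e')
            = (\<Sum>e'\<in>E. a {x, y} e' * \<omega> t e') * exp (- ((\<rho> - 2) * t))"
          by (simp add: u_def sum_distrib_right mult.assoc)
        then show ?case using curv[OF elim xy] by (simp add: u_def)
      qed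
    qed
  qed
  then show thesis
    using v c eigen[unfolded a_def] lim[unfolded u_def] by (intro that[of v c \<rho>])
qed

theorem theorem1p3:
  fixes V :: "'a set" and E :: "'a set set" and n :: nat
    and \<omega>0 :: "'a set \<Rightarrow> real" and \<omega> :: "real \<Rightarrow> 'a set \<Rightarrow> real"
    and m1 :: "'a \<Rightarrow> real" and m2 :: "'a set \<Rightarrow> real"
    and \<kappa> :: "real \<Rightarrow> 'a \<Rightarrow> 'a \<Rightarrow> real"
  assumes tree: "finite_tree V E" and edges: "card E = n" and n: "n \<ge> 1"
    and m1: "\<And>x. x \<in> V \<Longrightarrow> m1 x = 1" and m2: "\<And>e. e \<in> E \<Longrightarrow> m2 e = 1"
    and init: "\<And>e. e \<in> E \<Longrightarrow> 0 < \<omega>0 e"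
    and flow: "ricci_flow V E m1 m2 \<omega>0 \<omega>"
    and kappa: "\<And>t x y. \<kappa> t x y = lly_curvature V E m1 m2 (\<omega> t) x y"
  shows "(is_path V E \<longrightarrow>
            (\<forall>e\<in>E. ((\<lambda>t. \<omega> t e) \<longlongrightarrow> 0) at_top) \<and>
            (\<exists>c>0. \<forall>x y. {x, y} \<in> E \<longrightarrow> ((\<lambda>t. \<kappa> t x y) \<longlongrightarrow> c) at_top)) \<and>
         (is_K13 V E \<longrightarrow>
            (\<forall>e\<in>E. \<exists>L. L \<noteq> 0 \<and> ((\<lambda>t. \<omega> t e) \<longlongrightarrow> L) at_top) \<and>
            (\<forall>x y. {x, y} \<in> E \<longrightarrow> ((\<lambda>t. \<kappa> t x y) \<longlongrightarrow> 0) at_top)) \<and>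
         (Max (vertex_degree V E ` V) \<ge> 3 \<and> \<not> is_K13 V E \<longrightarrow>
            (\<forall>e\<in>E. filterlim (\<lambda>t. \<omega> t e) at_top at_top) \<and>
            (\<exists>c<0. \<forall>x y. {x, y} \<in> E \<longrightarrow> ((\<lambda>t. \<kappa> t x y) \<longlongrightarrow> c) at_top))"
proof -
  have ne: "E \<noteq> {}" using edges n by auto
  obtain v \<rho> c where v: "\<And>e. e \<in> E \<Longrightarrow> v e > 0" and c: "c > 0"
    and eigen: "\<And>e. e \<in> E \<Longrightarrow> (\<Sum>e'\<in>E. of_bool (adjacent_edges e e') * v e') = \<rho> * v e"
    and lim: "\<And>e. e \<in> E \<Longrightarrow> ((\<lambda>t. \<omega> t e * exp (- ((\<rho> - 2) * t))) \<longlongrightarrow> c * v e) at_top"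
    and "\<And>x y. {x, y} \<in> E \<Longrightarrow>
      ((\<lambda>t. lly_curvature V E m1 m2 (\<omega> t) x y) \<longlongrightarrow> 2 - \<rho>) at_top"
    using m1 m2 flow by (rule ricci_flow_asymptotics[OF tree ne]) (assumption, assumption, rule that)
  then have curv: "\<And>x y. {x, y} \<in> E \<Longrightarrow> ((\<lambda>t. \<kappa> t x y) \<longlongrightarrow> 2 - \<rho>) at_top"
    by (simp add: kappa)
  have cv: "c * v e > 0" if "e \<in> E" for e using c v[OF that] by simp
  \<comment> \<open>A factor with a positive limit times a pure exponential: the sign of
    \<open>\<rho> - 2\<close> alone decides the behaviour of the weights.\<close>
  have \<omega>: "(\<lambda>t. \<omega> t e) = (\<lambda>t. (\<omega> t e * exp (- ((\<rho> - 2) * t))) * exp ((\<rho> - 2) * t))" for e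
    by (rule ext) (simp add: exp_minus)
  have finE: "finite E" using tree by (rule finite_tree_edges)
  show ?thesis
  proof (intro conjI impI ballI)
    assume "is_path V E"
    then have \<rho>: "\<rho> < 2"
      using finE ne v eigen by (rule path_spectral_radius_less)
    show "((\<lambda>t. \<omega> t e) \<longlongrightarrow> 0) at_top" if e: "e \<in> E" for e
    proof -
      have "filterlim (\<lambda>t. (\<rho> - 2) * t) at_bot at_top"
        using \<rho> by (intro filterlim_tendsto_neg_mult_at_bot[OF tendsto_const _ filterlim_ident]) simp
      then have "((\<lambda>t. exp ((\<rho> - 2) * t)) \<longlongrightarrow> 0) at_top"
        by (rule filterlim_compose[OF exp_at_bot])
      from tendsto_mult[OF lim[OF e] this] show ?thesis by (subst \<omega>) simp
    qed
    show "\<exists>c>0. \<forall>x y. {x, y} \<in> E \<longrightarrow> ((\<lambda>t. \<kappa> t x y) \<longlongrightarrow> c) at_top"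
      using \<rho> curv by (intro exI[of _ "2 - \<rho>"]) simp
  next
    assume "is_K13 V E"
    then have \<rho>: "\<rho> = 2"
      using v eigen by (rule K13_spectral_radius)
    show "\<exists>L. L \<noteq> 0 \<and> ((\<lambda>t. \<omega> t e) \<longlongrightarrow> L) at_top" if e: "e \<in> E" for e
      using lim[OF e] cv[OF e] \<rho> by (intro exI[of _ "c * v e"]) auto
    show "\<forall>x y. {x, y} \<in> E \<longrightarrow> ((\<lambda>t. \<kappa> t x y) \<longlongrightarrow> 0) at_top"
      using curv \<rho> by simp
  next
    assume "3 \<le> Max (vertex_degree V E ` V) \<and> \<not> is_K13 V E"
    then have \<rho>: "\<rho> > 2"
      using branching_spectral_radius_greater[OF tree _ _ v eigen] by blast
    show "filterlim (\<lambda>t. \<omega> t e) at_top at_top" if e: "e \<in> E" for e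
    proof -
      have "filterlim (\<lambda>t. (\<rho> - 2) * t) at_top at_top"
        using \<rho> by (intro filterlim_tendsto_pos_mult_at_top[OF tendsto_const _ filterlim_ident]) simp
      then have "filterlim (\<lambda>t. exp ((\<rho> - 2) * t)) at_top at_top"
        by (rule filterlim_compose[OF exp_at_top])
      then show ?thesis
        by (subst \<omega>) (rule filterlim_tendsto_pos_mult_at_top[OF lim[OF e] cv[OF e]])
    qed
    show "\<exists>c<0. \<forall>x y. {x, y} \<in> E \<longrightarrow> ((\<lambda>t. \<kappa> t x y) \<longlongrightarrow> c) at_top"
      using \<rho> curv by (intro exI[of _ "2 - \<rho>"]) simp
  qed
qed

end
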